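(* For an integer $k\ge 2$ let $\Delta_3(k)=\min_P\bigl(f_{d-1}(P)-f_0(P)\bigr)$, where the minimum is over all $d$ and all $k$-neighborly $d$-polytopes $P$ with exactly $f_0(P)=d+3$ vertices. Then $\Delta_3(2)=4$, $\Delta_3(3)=15$, and $\Delta_3(k)=2(k^2-1)$ for every $k\ge 4$.
   Context: A $d$-polytope is a convex polytope of dimension $d$. $f_0(P)$ is the number of vertices and $f_{d-1}(P)$ the number of facets of a $d$-polytope $P$. A $d$-polytope $P$ is called $k$-neighborly if every set of $k$ vertices of $P$ is the vertex set of a face of $P$. (The only $k$-neighborly $d$-polytope with $k>\lfloor d/2\rfloor$ is the simplex, so $d\ge 2k$ is assumed.) *)

theory Defs
  imports "HOL-Analysis.Analysis" "HOL-Analysis.Finite_Function_Topology"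
begin

text \<open>
  The minimum below ranges over polytopes of all dimensions at once, which cannot be
  expressed with the dimension in the type.  Polytopes therefore live in the space
  \<^typ>\<open>nat \<Rightarrow>\<^sub>0 real\<close> of finitely supported real sequences: each Euclidean space embeds
  in it linearly as the sequences supported on an initial segment, and every polytope in it
  lies in such a copy. The library's \<^const>\<open>polytope\<close>, \<^const>\<open>face_of\<close> and
  \<^const>\<open>extreme_point_of\<close> are available in every real vector space, but
  \<^const>\<open>aff_dim\<close> and \<^const>\<open>facet_of\<close> only in Euclidean spaces.
  The next two definitions carry these over; the lemmas show that they agree with the
  library's where both apply.
\<close>

text \<open>Finiteness of \<open>B\<close> is demanded since an infinite set has cardinality 0 in HOL,
  so that an infinite-dimensional set would have dimension \<open>-1\<close>.\<close>

definition has_aff_dim :: "'a::real_vector set \<Rightarrow> int \<Rightarrow> bool" where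
  "has_aff_dim S n \<longleftrightarrow>
     (\<exists>B. finite B \<and> \<not> affine_dependent B \<and> affine hull B = affine hull S \<and>
          int (card B) = n + 1)"

lemma has_aff_dim_iff_aff_dim:
  fixes S :: "'a::euclidean_space set"
  shows "has_aff_dim S n \<longleftrightarrow> aff_dim S = n"
proof
  assume "has_aff_dim S n"
  then obtain B where "\<not> affine_dependent B" "affine hull B = affine hull S"
      "int (card B) = n + 1"
    unfolding has_aff_dim_def by blast
  then show "aff_dim S = n"
    using aff_dim_unique[of B S] by simp
next
  assume n: "aff_dim S = n"
  obtain B where B: "affine hull B = affine hull S" "\<not> affine_dependent B"
      "of_nat (card B) = aff_dim S + 1"
    using aff_dim_basis_exists[of S] by blast
  then have "finite B"
    using aff_independent_finite by blast
  with B n show "has_aff_dim S n"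
    unfolding has_aff_dim_def by auto
qed

definition facets :: "'a::real_vector set \<Rightarrow> 'a set set" where
  "facets P = {F. F face_of P \<and> F \<noteq> {} \<and>
                  (\<exists>d. has_aff_dim P d \<and> has_aff_dim F (d - 1))}"

lemma facets_eq_facet_of:
  fixes P :: "'a::euclidean_space set"
  shows "facets P = {F. F facet_of P}"
  unfolding facets_def facet_of_def has_aff_dim_iff_aff_dim by auto

definition vertices :: "'a::real_vector set \<Rightarrow> 'a set" where
  "vertices P = {v. v extreme_point_of P}"

definition d_polytope :: "nat \<Rightarrow> 'a::real_vector set \<Rightarrow> bool" where
  "d_polytope d P \<longleftrightarrow> polytope P \<and> has_aff_dim P (int d)"

definition neighborly :: "nat \<Rightarrow> 'a::real_vector set \<Rightarrow> bool" where
  "neighborly k P \<longleftrightarrow>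
     (\<forall>S. S \<subseteq> vertices P \<and> card S = k \<longrightarrow> (\<exists>F. F face_of P \<and> vertices F = S))"

text \<open>The bound \<open>2 * k \<le> d\<close> excludes low-dimensional polytopes for which \<open>neighborly k\<close>
  is degenerate because they have at most \<open>k\<close> vertices.\<close>

definition excess_values :: "nat \<Rightarrow> int set" where
  "excess_values k =
     {int (card (facets P)) - int (card (vertices P)) | (P :: (nat \<Rightarrow>\<^sub>0 real) set) d.
        d_polytope d P \<and> 2 * k \<le> d \<and> neighborly k P \<and> card (vertices P) = d + 3}"

definition Delta3 :: "nat \<Rightarrow> int" where
  "Delta3 k = (LEAST m. m \<in> excess_values k)"

end

(*  A polytope with d + 3 vertices has a Gale diagram in the plane: facets correspond to the
    supports of minimal positive dependences (a zero vector, an opposite pair, or a triple with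
    the origin inside), and k-neighborliness says that every open half-plane contains at least
    K = k + 1 vectors.

    Zero vectors do not change the difference facets - vertices.  If there are more than 4K
    vectors, one of them can be deleted: take an open half-plane with exactly K vectors and delete
    an angular median of the rest.  So let n <= 4K.  For each vector p let s be the number of
    vectors on its line, e the number of vectors in direction p minus the number in direction -p,
    and D the difference of the numbers of vectors on the two sides of its line.  Expressing the
    orientation of triples through the signs of cross products yields the exact formula
      24 (facets - n) = sum_p (n^2 - 3ns + 2s^2 + 6s - 24 - 3 D^2 + 3 e (n - s - 2)).
    The terms with e have nonnegative sum, since e sums to (x - y)^2 over a line with x and y
    vectors in its two directions, and |D| <= n - s - 2K.  The resulting bound is minimal for s = n - 2K,
    and is then a concave function of n on [2K + 1, 4K], which gives the lower bound.

    Equality holds for two lines with K vectors in each of the four directions (k >= 4), and for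
    k + 2 lines with one vector in each direction (k = 2, 3). *)

theory Submission
  imports Defs
begin

subsection \<open>Circuits of planar vector configurations\<close>

text \<open>Polytopes and plane vectors are linked by one duality: the value lists of affine
  functionals on the vertices are exactly the coefficient lists of linear dependences among the
  vectors. A functional supporting a facet becomes a positive dependence on the complement of the
  facet, and codimension one becomes uniqueness of that dependence up to scaling. The obstacle is
  that, once D is replaced by its bound, each summand is a concave quadratic in s on [1, n - 2K].
  Its excess over the value at s = n - 2K is (n - 2K - s)(10K - 2n - 6 + s), which becomes negative
  for small s if n is large against K. The deletion step removes this range: n <= 4K makes both
  factors nonnegative. Of the two endpoints for n, n = 4K gives 2(k^2 - 1) and n = 2K + 1 is larger
  only from K = 5 on. For K = 3 and K = 4 it gives the smaller values 7/2 and 57/4; the count is an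
  integer, so these still yield 4 and 15, which explains the exceptional cases.\<close>

definition cr :: "complex \<Rightarrow> complex \<Rightarrow> real" where
  "cr a b = Re a * Im b - Im a * Re b"

definition opp :: "complex \<Rightarrow> complex \<Rightarrow> bool" where
  "opp a b \<longleftrightarrow> cr a b = 0 \<and> a \<bullet> b < 0"

text \<open>The origin lies inside the triangle \<open>a\<close>, \<open>b\<close>,
  \<open>c\<close>, listed counterclockwise. Rotating the list preserves the property, a
  transposition destroys it.\<close>

definition tri :: "complex \<Rightarrow> complex \<Rightarrow> complex \<Rightarrow> bool" where
  "tri a b c \<longleftrightarrow> 0 < cr a b \<and> 0 < cr b c \<and> 0 < cr c a"

text \<open>Uniqueness up to scaling replaces minimality of the support: it is the form in which a
  facet supplies it, and \<open>circuit_minimal\<close> recovers minimality.\<close>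

definition pos_circuit :: "('a \<Rightarrow> complex) \<Rightarrow> 'a set \<Rightarrow> bool" where
  "pos_circuit g C \<longleftrightarrow> C \<noteq> {} \<and>
     (\<exists>c. (\<forall>v\<in>C. 0 < c v) \<and> (\<Sum>v\<in>C. c v *\<^sub>R g v) = 0 \<and>
          (\<forall>c'. (\<Sum>v\<in>C. c' v *\<^sub>R g v) = 0 \<longrightarrow> (\<exists>t. \<forall>v\<in>C. c' v = t * c v)))"

definition circuits :: "'a set \<Rightarrow> ('a \<Rightarrow> complex) \<Rightarrow> 'a set set" where
  "circuits V g = {C. C \<subseteq> V \<and> pos_circuit g C}"

definition half_planes :: "nat \<Rightarrow> 'a set \<Rightarrow> ('a \<Rightarrow> complex) \<Rightarrow> bool" where
  "half_planes K V g \<longleftrightarrow> (\<forall>z. z \<noteq> 0 \<longrightarrow> K \<le> card {v\<in>V. 0 < z \<bullet> g v})"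

lemma cr_swap: "cr b a = - cr a b"
  by (simp add: cr_def)

lemma cr_self [simp]: "cr a a = 0"
  by (simp add: cr_def)

lemma inner_ii: "(\<i> * a) \<bullet> b = cr a b"
  by (simp add: cr_def inner_complex_def)

lemma inner_complex_eq: "a \<bullet> b = Re a * Re b + Im a * Im b" for a b :: complex
  by (simp add: inner_complex_def)

text \<open>The determinant of \<open>b\<close> and \<open>c\<close> in the orthogonal basis
  \<open>a\<close>, \<open>\<i> * a\<close>, where a vector \<open>v\<close> has coordinates
  proportional to \<open>a \<bullet> v\<close> and \<open>cr a v\<close>.\<close>

lemma cr_expand: "(a \<bullet> a) * cr b c = (a \<bullet> b) * cr a c - (a \<bullet> c) * cr a b"
  unfolding cr_def inner_complex_eq by algebra

lemma cr_eq0_same: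
  assumes "cr a b = 0" "a \<noteq> 0" "b \<noteq> 0"
  shows "a \<bullet> b \<noteq> 0"
proof
  assume "a \<bullet> b = 0"
  moreover have "(a \<bullet> b)\<^sup>2 + (cr a b)\<^sup>2 = (a \<bullet> a) * (b \<bullet> b)"
    unfolding cr_def inner_complex_eq by algebra
  ultimately show False using assms by simp
qed

lemma sum_scaleR_zero_cr:
  assumes "(\<Sum>v\<in>C. c v *\<^sub>R g v) = 0"
  shows "(\<Sum>v\<in>C. c v * cr z (g v)) = 0"
proof -
  have "(\<Sum>v\<in>C. c v * cr z (g v)) = (\<i> * z) \<bullet> (\<Sum>v\<in>C. c v *\<^sub>R g v)"
    by (simp add: inner_sum_right inner_ii)
  then show ?thesis by (simp add: assms)
qed

lemma sum_scaleR_zero_inner: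
  fixes g :: "'a \<Rightarrow> complex"
  assumes "(\<Sum>v\<in>C. c v *\<^sub>R g v) = 0"
  shows "(\<Sum>v\<in>C. c v * (z \<bullet> g v)) = 0"
proof -
  have "(\<Sum>v\<in>C. c v * (z \<bullet> g v)) = z \<bullet> (\<Sum>v\<in>C. c v *\<^sub>R g v)"
    by (simp add: inner_sum_right)
  then show ?thesis by (simp add: assms)
qed

lemma pos_circuit_singleton: "g v = 0 \<Longrightarrow> pos_circuit g {v}"
  unfolding pos_circuit_def by (auto intro!: exI[of _ "\<lambda>_. 1"])

lemma pos_circuit_pair:
  assumes "opp (g p) (g q)"
  shows "pos_circuit g {p, q}"
proof -
  let ?a = "g p" and ?b = "g q"
  have cr: "cr ?a ?b = 0" and neg: "?a \<bullet> ?b < 0"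
    using assms by (auto simp: opp_def)
  have pq: "p \<noteq> q" using neg inner_ge_zero[of ?a] by (metis not_less)
  have bb: "?b \<bullet> ?b > 0" using neg by auto
  define c where "c = (\<lambda>v. if v = p then ?b \<bullet> ?b else - (?a \<bullet> ?b))"
  \<comment> \<open>A multiple of the component of \<open>?a\<close> orthogonal to
    \<open>?b\<close>, which is zero for parallel vectors.\<close>
  have "(?b \<bullet> ?b) *\<^sub>R ?a + (- (?a \<bullet> ?b)) *\<^sub>R ?b = 0"
  proof (rule complex_eqI)
    have "Re ((?b \<bullet> ?b) *\<^sub>R ?a + (- (?a \<bullet> ?b)) *\<^sub>R ?b) = Im ?b * cr ?a ?b"
      unfolding cr_def inner_complex_eq by (simp add: algebra_simps)
    then show "Re ((?b \<bullet> ?b) *\<^sub>R ?a + (- (?a \<bullet> ?b)) *\<^sub>R ?b) = Re 0" using cr by simp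
    have "Im ((?b \<bullet> ?b) *\<^sub>R ?a + (- (?a \<bullet> ?b)) *\<^sub>R ?b) = - Re ?b * cr ?a ?b"
      unfolding cr_def inner_complex_eq by (simp add: algebra_simps)
    then show "Im ((?b \<bullet> ?b) *\<^sub>R ?a + (- (?a \<bullet> ?b)) *\<^sub>R ?b) = Im 0" using cr by simp
  qed
  then have s0: "(\<Sum>v\<in>{p,q}. c v *\<^sub>R g v) = 0" using pq by (simp add: c_def)
  have u: "\<exists>t. \<forall>v\<in>{p,q}. c' v = t * c v" if "(\<Sum>v\<in>{p,q}. c' v *\<^sub>R g v) = 0" for c'
  proof -
    have "c' p * (?b \<bullet> ?a) + c' q * (?b \<bullet> ?b) = 0"
      using sum_scaleR_zero_inner[OF that, of ?b] pq by simp
    then show ?thesis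
      using pq bb by (intro exI[of _ "c' p / (?b \<bullet> ?b)"])
        (auto simp: c_def field_simps inner_commute)
  qed
  have "\<forall>v\<in>{p,q}. 0 < c v" using bb neg pq by (simp add: c_def)
  with s0 u show ?thesis unfolding pos_circuit_def by blast
qed

text \<open>The coefficients are those of Cramer's rule, and \<open>tri\<close> makes them positive.
  For uniqueness, applying \<open>cr\<close> with one of the three vectors to a dependence
  eliminates that vector's coefficient.\<close>

lemma pos_circuit_triple:
  assumes "tri (g p) (g q) (g r)"
  shows "pos_circuit g {p, q, r}"
proof -
  let ?a = "g p" and ?b = "g q" and ?c = "g r"
  have ab: "cr ?a ?b > 0" and bc: "cr ?b ?c > 0" and ca: "cr ?c ?a > 0"
    using assms by (auto simp: tri_def)
  have d: "p \<noteq> q" "q \<noteq> r" "r \<noteq> p" using ab bc ca cr_self by (metis less_irrefl)+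
  define c where "c = (\<lambda>v. if v = p then cr ?b ?c else if v = q then cr ?c ?a else cr ?a ?b)"
  have "cr ?b ?c *\<^sub>R ?a + (cr ?c ?a *\<^sub>R ?b + cr ?a ?b *\<^sub>R ?c) = 0"
    by (rule complex_eqI) (simp_all add: cr_def algebra_simps)
  then have s0: "(\<Sum>v\<in>{p,q,r}. c v *\<^sub>R g v) = 0" using d by (simp add: c_def)
  have u: "\<exists>t. \<forall>v\<in>{p,q,r}. c' v = t * c v" if "(\<Sum>v\<in>{p,q,r}. c' v *\<^sub>R g v) = 0" for c'
  proof -
    have "c' p * cr ?c ?a + c' q * cr ?c ?b = 0" "c' p * cr ?b ?a + c' r * cr ?b ?c = 0"
      using sum_scaleR_zero_cr[OF that, of ?c] sum_scaleR_zero_cr[OF that, of ?b] d by simp_all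
    then show ?thesis
      using d bc cr_swap[of ?b ?c] cr_swap[of ?a ?b]
      by (intro exI[of _ "c' p / cr ?b ?c"]) (auto simp: c_def field_simps)
  qed
  have "\<forall>v\<in>{p,q,r}. 0 < c v" using ab bc ca d by (auto simp: c_def)
  with s0 u show ?thesis unfolding pos_circuit_def by blast
qed

text \<open>Extended by zero, the dependence on \<open>D\<close> is a nonzero multiple of the one on
  \<open>C\<close>, so it vanishes nowhere on \<open>C\<close>.\<close>

lemma circuit_minimal:
  assumes C: "pos_circuit g C" and D: "pos_circuit g D" and sub: "D \<subseteq> C" and fin: "finite C"
  shows "D = C"
proof -
  obtain d where d: "\<And>v. v \<in> D \<Longrightarrow> 0 < d v" "(\<Sum>v\<in>D. d v *\<^sub>R g v) = 0" and "D \<noteq> {}"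
    using D unfolding pos_circuit_def by blast
  obtain c where u: "\<And>c'. (\<Sum>v\<in>C. c' v *\<^sub>R g v) = 0 \<Longrightarrow> \<exists>t. \<forall>v\<in>C. c' v = t * c v"
      and c: "\<And>v. v \<in> C \<Longrightarrow> 0 < c v"
    using C unfolding pos_circuit_def by blast
  let ?d = "\<lambda>v. if v \<in> D then d v else 0"
  have "(\<Sum>v\<in>C. ?d v *\<^sub>R g v) = (\<Sum>v\<in>D. ?d v *\<^sub>R g v)"
    using sub fin by (intro sum.mono_neutral_right) auto
  also have "\<dots> = 0" using d(2) by simp
  finally have "\<exists>t. \<forall>v\<in>C. ?d v = t * c v" by (rule u)
  then obtain t where t: "\<And>v. v \<in> C \<Longrightarrow> ?d v = t * c v" by blast
  from \<open>D \<noteq> {}\<close> obtain w where "w \<in> D" by blast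
  with t[of w] d(1)[of w] sub have "t \<noteq> 0" by auto
  have "C \<subseteq> D"
  proof
    fix v assume "v \<in> C"
    with t[of v] c[of v] \<open>t \<noteq> 0\<close> show "v \<in> D" by (auto split: if_splits)
  qed
  with sub show ?thesis by blast
qed

text \<open>Go counterclockwise from \<open>p\<close> to the last vector \<open>q\<close> in the
  open half-plane to its left. \<open>H\<close> yields some \<open>r\<close> to the left of
  \<open>q\<close>. By the choice of \<open>q\<close> it is not left of \<open>p\<close>, so it is
  opposite to \<open>p\<close> or lies to the right and closes a triple.\<close>

lemma circuit_through:
  assumes fin: "finite C" and p: "p \<in> C" and nz: "g p \<noteq> 0"
    and H: "\<And>z v. v \<in> C \<Longrightarrow> z \<bullet> g v < 0 \<Longrightarrow> \<exists>r\<in>C. 0 < z \<bullet> g r"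
  shows "(\<exists>q\<in>C. opp (g p) (g q)) \<or> (\<exists>q\<in>C. \<exists>r\<in>C. tri (g p) (g q) (g r))"
proof (rule ccontr)
  assume neg: "\<not> ?thesis"
  have pp: "g p \<bullet> g p > 0" using nz by simp
  define L where "L = {v\<in>C. 0 < cr (g p) (g v)}"
  have "L \<noteq> {}"
  proof -
    obtain r where r: "r \<in> C" "g p \<bullet> g r < 0"
      using H[of p "- g p"] p pp by auto
    then have "cr (g p) (g r) \<noteq> 0" using neg by (auto simp: opp_def)
    then show ?thesis
      using r H[of r "\<i> * g p"] unfolding L_def inner_ii by (metis (mono_tags, lifting) empty_iff linorder_neqE_linordered_idom mem_Collect_eq)
  qed
  \<comment> \<open>The cotangent of the angle from \<open>g p\<close> to \<open>g v\<close>; its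
    minimum over \<open>L\<close> is attained at the largest angle.\<close>
  define k where "k = (\<lambda>v. (g p \<bullet> g v) / cr (g p) (g v))"
  have "finite L" using fin by (simp add: L_def)
  with \<open>L \<noteq> {}\<close> obtain q where q: "q \<in> L" and qmin: "\<And>v. v \<in> L \<Longrightarrow> k q \<le> k v"
    by (metis arg_min_if_finite(1) arg_min_least)
  have pq: "0 < cr (g p) (g q)" "q \<in> C" using q by (auto simp: L_def)
  then obtain r where r: "r \<in> C" "0 < cr (g q) (g r)"
    using H[of p "\<i> * g q"] p unfolding inner_ii using cr_swap[of "g p" "g q"] by auto
  have pos: "0 < (g p \<bullet> g q) * cr (g p) (g r) - (g p \<bullet> g r) * cr (g p) (g q)"
    using cr_expand[of "g p" "g q" "g r"] r(2) pp by (metis mult_pos_pos)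
  consider "0 < cr (g p) (g r)" | "cr (g p) (g r) = 0" | "cr (g p) (g r) < 0" by linarith
  then show False
  proof cases
    case 1
    then have "k q \<le> k r" using qmin r(1) by (simp add: L_def)
    then show False using 1 pos pq(1) by (simp add: k_def field_simps)
  next
    case 2
    then have "0 \<le> g p \<bullet> g r" using neg r(1) by (auto simp: opp_def)
    then have "0 \<le> (g p \<bullet> g r) * cr (g p) (g q)" using pq(1) by simp
    then show False using 2 pos by simp
  next
    case 3
    then have "tri (g p) (g q) (g r)" using pq(1) r(2) cr_swap[of "g p" "g r"] by (simp add: tri_def)
    then show False using neg pq(2) r(1) by blast
  qed
qed

definition opp_pairs :: "'a set \<Rightarrow> ('a \<Rightarrow> complex) \<Rightarrow> 'a set set" where
  "opp_pairs V g = (\<lambda>(p,q). {p, q}) ` {(p,q) \<in> V \<times> V. opp (g p) (g q)}"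

definition pos_triples :: "'a set \<Rightarrow> ('a \<Rightarrow> complex) \<Rightarrow> 'a set set" where
  "pos_triples V g = (\<lambda>(p,q,r). {p, q, r}) ` {(p,q,r) \<in> V \<times> V \<times> V. tri (g p) (g q) (g r)}"

text \<open>The positive coefficients of a circuit provide the hypothesis of
  \<open>circuit_through\<close>. The pair or triple found is itself a circuit, so by minimality it
  is the whole circuit.\<close>

lemma circuits_eq:
  assumes fin: "finite V" and nz: "\<And>v. v \<in> V \<Longrightarrow> g v \<noteq> 0"
  shows "circuits V g = opp_pairs V g \<union> pos_triples V g"
proof (intro equalityI subsetI)
  fix C assume "C \<in> opp_pairs V g \<union> pos_triples V g"
  then show "C \<in> circuits V g"
    unfolding opp_pairs_def pos_triples_def circuits_def
    using pos_circuit_pair pos_circuit_triple by fast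
next
  fix C assume "C \<in> circuits V g"
  then have sub: "C \<subseteq> V" and pc: "pos_circuit g C" by (auto simp: circuits_def)
  then have fC: "finite C" using fin finite_subset by blast
  obtain c where c: "\<And>v. v \<in> C \<Longrightarrow> 0 < c v" and s0: "(\<Sum>v\<in>C. c v *\<^sub>R g v) = 0" and ne: "C \<noteq> {}"
    using pc unfolding pos_circuit_def by blast
  then obtain p where p: "p \<in> C" by blast
  have H: "\<exists>r\<in>C. 0 < z \<bullet> g r" if "v \<in> C" "z \<bullet> g v < 0" for z v
  proof (rule ccontr)
    assume "\<not> ?thesis"
    then have nn: "\<And>r. r \<in> C \<Longrightarrow> 0 \<le> c r * (- z \<bullet> g r)"
      using c by (simp add: mult_nonneg_nonpos less_imp_le not_less)
    have "0 < c v * (- z \<bullet> g v)" using that c by (simp add: mult_pos_neg)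
    then have "0 < (\<Sum>r\<in>C. c r * (- z \<bullet> g r))"
      using sum_pos2[OF fC that(1), of "\<lambda>r. c r * (- z \<bullet> g r)"] nn by simp
    then show False using sum_scaleR_zero_inner[OF s0, of "- z"] by simp
  qed
  have "(\<exists>q\<in>C. opp (g p) (g q)) \<or> (\<exists>q\<in>C. \<exists>r\<in>C. tri (g p) (g q) (g r))"
    by (rule circuit_through[OF fC p]) (use nz sub p H in auto)
  then consider q where "q \<in> C" "opp (g p) (g q)" | q r where "q \<in> C" "r \<in> C" "tri (g p) (g q) (g r)"
    by blast
  then show "C \<in> opp_pairs V g \<union> pos_triples V g"
  proof cases
    case 1
    then have "{p,q} = C" using circuit_minimal[OF pc pos_circuit_pair] fC p by auto
    then show ?thesis using 1 p sub unfolding opp_pairs_def by (intro UnI1) (auto intro!: image_eqI[of _ _ "(p,q)"])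
  next
    case 2
    then have "{p,q,r} = C" using circuit_minimal[OF pc pos_circuit_triple] fC p by auto
    then show ?thesis using 2 p sub unfolding pos_triples_def by (intro UnI2) (auto intro!: image_eqI[of _ _ "(p,q,r)"])
  qed
qed

subsection \<open>Counting circuits\<close>

lemma sum_swap_cyc:
  fixes F :: "'a \<Rightarrow> 'a \<Rightarrow> 'a \<Rightarrow> real"
  shows "(\<Sum>p\<in>V. \<Sum>q\<in>V. \<Sum>r\<in>V. F p q r) = (\<Sum>q\<in>V. \<Sum>r\<in>V. \<Sum>p\<in>V. F p q r)"
proof -
  have "(\<Sum>p\<in>V. \<Sum>q\<in>V. \<Sum>r\<in>V. F p q r) = (\<Sum>q\<in>V. \<Sum>p\<in>V. \<Sum>r\<in>V. F p q r)"
    by (rule sum.swap)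
  also have "\<dots> = (\<Sum>q\<in>V. \<Sum>r\<in>V. \<Sum>p\<in>V. F p q r)"
    by (intro sum.cong refl sum.swap)
  finally show ?thesis .
qed

section \<open>Signs of cross products and the number of positive triples\<close>

definition par :: "complex \<Rightarrow> complex \<Rightarrow> real" where
  "par a b = of_bool (cr a b = 0)"

text \<open>For nonzero vectors: 1 for equal directions, -1 for opposite directions, 0 for
  nonparallel ones.\<close>

definition orient :: "complex \<Rightarrow> complex \<Rightarrow> real" where
  "orient a b = of_bool (cr a b = 0) - 2 * of_bool (opp a b)"

definition sg :: "complex \<Rightarrow> complex \<Rightarrow> real" where
  "sg a b = sgn (cr a b)"

lemma sg_swap: "sg b a = - sg a b"
  by (simp add: sg_def cr_swap[of b a] sgn_minus)

lemma par_swap: "par b a = par a b"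
  by (simp add: par_def cr_swap[of b a])

lemma opp_swap: "opp b a \<longleftrightarrow> opp a b"
  by (auto simp: opp_def cr_swap[of b a] inner_commute)

lemma sg_orient:
  assumes "cr a b = 0" "a \<noteq> 0" "b \<noteq> 0"
  shows "sg b c = orient a b * sg a c"
proof -
  have aa: "a \<bullet> a > 0" using assms by simp
  have eq: "(a \<bullet> a) * cr b c = (a \<bullet> b) * cr a c" using cr_expand[of a b c] assms by simp
  have nz: "a \<bullet> b \<noteq> 0" using cr_eq0_same[OF assms] .
  have "sgn (cr b c) = sgn ((a \<bullet> a) * cr b c)" using aa by (simp add: sgn_mult)
  also have "\<dots> = sgn (a \<bullet> b) * sgn (cr a c)" by (simp add: eq sgn_mult)
  also have "sgn (a \<bullet> b) = orient a b"
    using nz assms(1) by (auto simp: orient_def opp_def sgn_if)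
  finally show ?thesis by (simp add: sg_def)
qed

lemma orient_cases:
  assumes "a \<noteq> 0" "b \<noteq> 0"
  shows "cr a b = 0 \<and> (orient a b = 1 \<or> orient a b = -1) \<or> cr a b \<noteq> 0 \<and> orient a b = 0"
  using assms by (auto simp: orient_def opp_def)

text \<open>If \<open>a\<close> and \<open>b\<close> are parallel, then \<open>sg b c * sg c a = - orient a b\<close> for every \<open>c\<close> off
  their line; these are the correction terms on the right-hand side.\<close>

lemma triple_identity:
  assumes nz: "a \<noteq> 0" "b \<noteq> 0" "c \<noteq> 0"
  shows "sg a b * sg b c + sg b c * sg c a + sg c a * sg a b =
    4 * of_bool (tri a b c) + 4 * of_bool (tri c b a)
    - (1 - par a b - par b c - par c a + 2 * (par a b * par b c))
    - orient a b * (1 - par c a) - orient b c * (1 - par a b) - orient c a * (1 - par b c)"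
proof -
  \<comment> \<open>The bracket in \<open>par\<close> indicates that no two of the vectors are
    parallel: two parallel pairs force the third, and then it is 1 - 3 + 2 = 0. In the generic case
    4 the three signs have pairwise products summing to 3 if they agree, that is, if the origin is
    inside the triangle, and to -1 otherwise.\<close>
  consider (0) "cr a b = 0" "cr b c = 0" | (1) "cr a b = 0" "cr b c \<noteq> 0"
    | (2) "cr b c = 0" "cr a b \<noteq> 0" | (3) "cr c a = 0" "cr a b \<noteq> 0" "cr b c \<noteq> 0"
    | (4) "cr a b \<noteq> 0" "cr b c \<noteq> 0" "cr c a \<noteq> 0" by blast
  then show ?thesis
  proof cases
    case 0
    have "sg c a = 0" using sg_orient[OF 0(1) nz(1,2), of c] orient_cases[OF nz(1,2)] 0
      sg_swap[of a c] by (auto simp: sg_def)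
    then have "cr c a = 0" by (simp add: sg_def sgn_eq_0_iff)
    then show ?thesis using 0 by (simp add: sg_def par_def tri_def cr_swap[of c b])
  next
    case 1
    have s: "sg b c = - orient a b * sg c a" using sg_orient[OF 1(1) nz(1,2), of c] sg_swap[of a c] by simp
    have ca: "cr c a \<noteq> 0" using s 1 by (auto simp: sg_def sgn_eq_0_iff)
    then have "sg c a * sg c a = 1" by (auto simp: sg_def sgn_if)
    then have "sg b c * sg c a = - orient a b" using s by simp
    moreover have "orient b c = 0" "orient c a = 0"
      using orient_cases nz 1 ca by blast+
    ultimately show ?thesis using 1 ca by (simp add: sg_def par_def tri_def cr_swap[of b a])
  next
    case 2
    have o: "orient b c * orient b c = 1" using orient_cases[OF nz(2,3)] 2 by auto
    have s: "sg c a = - orient b c * sg a b" using sg_orient[OF 2(1) nz(2,3), of a] sg_swap[of b a] by simp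
    have ca: "cr c a \<noteq> 0" using s 2 o by (auto simp: sg_def sgn_eq_0_iff)
    have "sg a b * sg a b = 1" using 2 by (auto simp: sg_def sgn_if)
    then have "sg c a * sg a b = - orient b c" using s by simp
    moreover have "orient a b = 0" "orient c a = 0"
      using orient_cases nz 2 ca by blast+
    ultimately show ?thesis using 2 ca by (simp add: sg_def par_def tri_def cr_swap[of c b])
  next
    case 3
    have s: "sg a b = - orient c a * sg b c" using sg_orient[OF 3(1) nz(3,1), of b] sg_swap[of c b] by simp
    have "sg b c * sg b c = 1" using 3 by (auto simp: sg_def sgn_if)
    then have "sg a b * sg b c = - orient c a" using s by simp
    moreover have "orient a b = 0" "orient b c = 0"
      using orient_cases nz 3 by blast+
    ultimately show ?thesis using 3 by (simp add: sg_def par_def tri_def cr_swap[of a c])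
  next
    case 4
    have "orient a b = 0" "orient b c = 0" "orient c a = 0"
      using orient_cases nz 4 by blast+
    then show ?thesis using 4
      by (auto simp: sg_def par_def tri_def sgn_if cr_swap[of b a] cr_swap[of c b] cr_swap[of a c])
  qed
qed

lemma par_trans:
  assumes "a \<noteq> 0" "b \<noteq> 0" "c \<noteq> 0" "cr a b = 0" "cr b c = 0"
  shows "cr a c = 0"
  using sg_orient[OF assms(4,1,2), of c] orient_cases[OF assms(1,2)] assms
  by (auto simp: sg_def sgn_eq_0_iff)

locale config =
  fixes V :: "'a set" and g :: "'a \<Rightarrow> complex"
  assumes fin: "finite V" and nz: "\<And>v. v \<in> V \<Longrightarrow> g v \<noteq> 0"
begin

definition s :: "'a \<Rightarrow> real" where "s p = (\<Sum>q\<in>V. par (g p) (g q))"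
definition e :: "'a \<Rightarrow> real" where "e p = (\<Sum>q\<in>V. orient (g p) (g q))"
definition D :: "'a \<Rightarrow> real" where "D p = (\<Sum>q\<in>V. sg (g p) (g q))"
definition y :: "'a \<Rightarrow> real" where "y p = real (card {q\<in>V. opp (g p) (g q)})"
abbreviation n :: real where "n \<equiv> real (card V)"

lemma s_card: "s p = real (card {q\<in>V. cr (g p) (g q) = 0})"
  using fin by (simp add: s_def par_def Int_def)

lemma y_sum: "y p = (\<Sum>q\<in>V. of_bool (opp (g p) (g q)))"
  using fin by (simp add: y_def Int_def)

lemma e_eq: "e p = s p - 2 * y p"
  by (simp add: e_def s_def y_sum orient_def par_def sum_subtractf sum_distrib_left)

definition \<tau> :: real where
  "\<tau> = (\<Sum>p\<in>V. \<Sum>q\<in>V. \<Sum>r\<in>V. of_bool (tri (g p) (g q) (g r)))"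

text \<open>\<open>triple_identity\<close> summed over all ordered triples. Summing
  \<open>sg p q * sg q r\<close> over \<open>p\<close> and \<open>r\<close> factors into
  \<open>- D q * D q\<close> by antisymmetry; the three cyclic forms of every term have the same
  sum, and both orientations of a triangle contribute \<open>\<tau>\<close>.\<close>

lemma count_identity:
  "8 * \<tau> = n^3 - 3 * n * (\<Sum>p\<in>V. s p) + 2 * (\<Sum>p\<in>V. (s p)\<^sup>2) - 3 * (\<Sum>p\<in>V. (D p)\<^sup>2)
     + 3 * (\<Sum>p\<in>V. e p * (n - s p))"
proof -
  let ?S = "\<lambda>F::'a \<Rightarrow> 'a \<Rightarrow> 'a \<Rightarrow> real. (\<Sum>p\<in>V. \<Sum>q\<in>V. \<Sum>r\<in>V. F p q r)"
  let ?sg = "\<lambda>p q. sg (g p) (g q)" and ?pa = "\<lambda>p q. par (g p) (g q)"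
    and ?o = "\<lambda>p q. orient (g p) (g q)"
  have lin: "?S (\<lambda>p q r. F p q r + G p q r) = ?S F + ?S G"
    "?S (\<lambda>p q r. F p q r - G p q r) = ?S F - ?S G"
    "?S (\<lambda>p q r. c * F p q r) = c * ?S F" for F G c
    by (simp_all add: sum.distrib sum_subtractf sum_distrib_left)
  have cyc: "?S (\<lambda>p q r. F q r p) = ?S F" "?S (\<lambda>p q r. F r p q) = ?S F" for F
    using sum_swap_cyc[of "\<lambda>p q r. F q r p" V] sum_swap_cyc[of F V] by simp_all
  have D2: "?S (\<lambda>p q r. ?sg p q * ?sg q r) = - (\<Sum>p\<in>V. (D p)\<^sup>2)"
  proof -
    have "?S (\<lambda>p q r. ?sg p q * ?sg q r) = (\<Sum>q\<in>V. \<Sum>r\<in>V. \<Sum>p\<in>V. ?sg p q * ?sg q r)"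
      by (rule sum_swap_cyc)
    also have "\<dots> = (\<Sum>q\<in>V. (\<Sum>r\<in>V. (\<Sum>p\<in>V. ?sg p q) * ?sg q r))"
      by (simp add: sum_distrib_right)
    also have "\<dots> = (\<Sum>q\<in>V. - (D q)\<^sup>2)"
    proof (intro sum.cong refl)
      fix q
      have "(\<Sum>p\<in>V. ?sg p q) = - D q"
        unfolding D_def sum_negf[symmetric] by (intro sum.cong refl sg_swap)
      moreover have "(\<Sum>r\<in>V. (- D q) * ?sg q r) = (- D q) * D q"
        by (simp only: D_def sum_distrib_left)
      ultimately show "(\<Sum>r\<in>V. (\<Sum>p\<in>V. ?sg p q) * ?sg q r) = - (D q)\<^sup>2"
        by (simp add: power2_eq_square)
    qed
    finally show ?thesis by (simp add: sum_negf)
  qed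
  have S1: "?S (\<lambda>p q r. 1) = n^3"
    by (simp add: power3_eq_cube)
  have Sl: "?S (\<lambda>p q r. ?pa p q) = n * (\<Sum>p\<in>V. s p)"
    by (simp add: s_def sum_distrib_left)
  have Sll: "?S (\<lambda>p q r. ?pa p q * ?pa q r) = (\<Sum>p\<in>V. (s p)\<^sup>2)"
  proof -
    have "?S (\<lambda>p q r. ?pa p q * ?pa q r) = (\<Sum>q\<in>V. \<Sum>r\<in>V. \<Sum>p\<in>V. ?pa p q * ?pa q r)"
      by (rule sum_swap_cyc)
    also have "\<dots> = (\<Sum>q\<in>V. (\<Sum>r\<in>V. (\<Sum>p\<in>V. ?pa q p) * ?pa q r))"
      by (simp add: sum_distrib_right par_swap)
    also have "\<dots> = (\<Sum>q\<in>V. (s q)\<^sup>2)"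
      by (simp add: s_def power2_eq_square sum_distrib_left)
    finally show ?thesis .
  qed
  have So: "?S (\<lambda>p q r. ?o p q * (1 - ?pa r p)) = (\<Sum>p\<in>V. e p * (n - s p))"
  proof -
    have "(\<Sum>r\<in>V. ?o p q * (1 - ?pa r p)) = ?o p q * (n - s p)" for p q
      by (simp add: s_def sum_subtractf par_swap[of "g p"] flip: sum_distrib_left)
    then show ?thesis by (simp add: e_def sum_distrib_right)
  qed
  have tau': "?S (\<lambda>p q r. of_bool (tri (g r) (g q) (g p))) = \<tau>"
  proof -
    have "?S (\<lambda>p q r. of_bool (tri (g r) (g q) (g p))) =
        (\<Sum>p\<in>V. \<Sum>r\<in>V. \<Sum>q\<in>V. of_bool (tri (g r) (g q) (g p)))"
      by (intro sum.cong refl sum.swap)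
    also have "\<dots> = \<tau>" unfolding \<tau>_def
      using cyc(1)[of "\<lambda>p q r. of_bool (tri (g p) (g q) (g r))"] by simp
    finally show ?thesis .
  qed
  have "?S (\<lambda>p q r. ?sg p q * ?sg q r + ?sg q r * ?sg r p + ?sg r p * ?sg p q) =
    ?S (\<lambda>p q r. 4 * of_bool (tri (g p) (g q) (g r)) + 4 * of_bool (tri (g r) (g q) (g p))
    - (1 - ?pa p q - ?pa q r - ?pa r p + 2 * (?pa p q * ?pa q r))
    - ?o p q * (1 - ?pa r p) - ?o q r * (1 - ?pa p q) - ?o r p * (1 - ?pa q r))"
    by (intro sum.cong refl triple_identity nz)
  then have "?S (\<lambda>p q r. ?sg p q * ?sg q r) + ?S (\<lambda>p q r. ?sg q r * ?sg r p)
      + ?S (\<lambda>p q r. ?sg r p * ?sg p q) =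
    4 * \<tau> + 4 * \<tau> - (?S (\<lambda>p q r. 1) - ?S (\<lambda>p q r. ?pa p q) - ?S (\<lambda>p q r. ?pa q r) - ?S (\<lambda>p q r. ?pa r p)
       + 2 * ?S (\<lambda>p q r. ?pa p q * ?pa q r))
    - ?S (\<lambda>p q r. ?o p q * (1 - ?pa r p)) - ?S (\<lambda>p q r. ?o q r * (1 - ?pa p q)) - ?S (\<lambda>p q r. ?o r p * (1 - ?pa q r))"
    unfolding lin tau' \<tau>_def[symmetric] .
  moreover have "?S (\<lambda>p q r. ?sg q r * ?sg r p) = ?S (\<lambda>p q r. ?sg p q * ?sg q r)"
    "?S (\<lambda>p q r. ?sg r p * ?sg p q) = ?S (\<lambda>p q r. ?sg p q * ?sg q r)"
    using cyc[of "\<lambda>p q r. ?sg p q * ?sg q r"] by simp_all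
  moreover have "?S (\<lambda>p q r. ?pa q r) = ?S (\<lambda>p q r. ?pa p q)" "?S (\<lambda>p q r. ?pa r p) = ?S (\<lambda>p q r. ?pa p q)"
    using cyc[of "\<lambda>p q r. ?pa p q"] by simp_all
  moreover have "?S (\<lambda>p q r. ?o q r * (1 - ?pa p q)) = ?S (\<lambda>p q r. ?o p q * (1 - ?pa r p))"
    "?S (\<lambda>p q r. ?o r p * (1 - ?pa q r)) = ?S (\<lambda>p q r. ?o p q * (1 - ?pa r p))"
    using cyc[of "\<lambda>p q r. ?o p q * (1 - ?pa r p)"] by simp_all
  ultimately show ?thesis unfolding D2 S1 Sl Sll So by linarith
qed

end

section \<open>From ordered pairs and triples to circuits; the excess formula and its
  estimate\<close>

lemma opp_irrefl: "\<not> opp a a"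
  by (simp add: opp_def not_less)

lemma orient_sgn:
  assumes "cr a b = 0" "a \<noteq> 0" "b \<noteq> 0"
  shows "orient a b = sgn (a \<bullet> b)"
  using cr_eq0_same[OF assms] assms(1) by (auto simp: orient_def opp_def sgn_if)

lemma orient_mult:
  assumes "cr a b = 0" and nz: "a \<noteq> 0" "b \<noteq> 0" "c \<noteq> 0"
  shows "orient b c = orient a b * orient a c"
proof (cases "cr a c = 0")
  case True
  have bc: "cr b c = 0" using par_trans[of b a c] assms True cr_swap[of a b] by simp
  have aa: "a \<bullet> a > 0" using nz by simp
  have "(a \<bullet> a) * (b \<bullet> c) = (a \<bullet> b) * (a \<bullet> c) + cr a b * cr a c"
    unfolding cr_def inner_complex_eq by algebra
  then have eq: "(a \<bullet> a) * (b \<bullet> c) = (a \<bullet> b) * (a \<bullet> c)" using assms(1) by simp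
  have "sgn (b \<bullet> c) = sgn ((a \<bullet> a) * (b \<bullet> c))" using aa by (simp add: sgn_mult)
  then show ?thesis using orient_sgn assms True bc by (simp add: eq sgn_mult)
next
  case False
  then have "cr b c \<noteq> 0" using par_trans[of a b c] assms by auto
  then have "orient b c = 0" "orient a c = 0" using False orient_cases nz by blast+
  then show ?thesis by simp
qed

lemma card_opp_pairs:
  assumes "finite V"
  shows "2 * card (opp_pairs V g) = card {(p,q) \<in> V \<times> V. opp (g p) (g q)}"
proof -
  let ?S = "{(p,q) \<in> V \<times> V. opp (g p) (g q)}" and ?f = "\<lambda>(p,q). {p, q}"
  have fS: "finite ?S" using assms by (intro finite_subset[of ?S "V \<times> V"]) auto
  have "card ?S = (\<Sum>x\<in>?S. 1)" by simp
  also have "\<dots> = (\<Sum>C\<in>?f ` ?S. \<Sum>x\<in>{x\<in>?S. ?f x = C}. 1)"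
    by (rule sum.image_gen[OF fS])
  also have "\<dots> = (\<Sum>C\<in>?f ` ?S. 2)"
  proof (intro sum.cong refl)
    fix C assume "C \<in> ?f ` ?S"
    then obtain p q where pq: "p \<in> V" "q \<in> V" "opp (g p) (g q)" and C: "C = {p, q}" by auto
    have ne: "p \<noteq> q" using pq(3) opp_irrefl by auto
    have "opp (g q) (g p)" using pq(3) opp_swap by blast
    then have sub: "{(p,q), (q,p)} \<subseteq> {x\<in>?S. ?f x = C}" using pq C by auto
    have "{x\<in>?S. ?f x = C} \<subseteq> {(p,q), (q,p)}"
    proof
      fix x assume x: "x \<in> {x\<in>?S. ?f x = C}"
      obtain a b where ab: "x = (a,b)" by (cases x)
      then have "{a,b} = {p,q}" using x C by simp
      then show "x \<in> {(p,q), (q,p)}" unfolding ab doubleton_eq_iff by blast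
    qed
    then have "{x\<in>?S. ?f x = C} = {(p,q), (q,p)}" using sub by (rule subset_antisym)
    then show "(\<Sum>x\<in>{x\<in>?S. ?f x = C}. 1) = 2" using ne by simp
  qed
  finally show ?thesis by (simp add: opp_pairs_def)
qed

lemma card_pos_triples:
  assumes "finite V"
  shows "3 * card (pos_triples V g) = card {(p,q,r) \<in> V \<times> V \<times> V. tri (g p) (g q) (g r)}"
proof -
  let ?S = "{(p,q,r) \<in> V \<times> V \<times> V. tri (g p) (g q) (g r)}" and ?f = "\<lambda>(p,q,r). {p, q, r}"
  have fS: "finite ?S" using assms by (intro finite_subset[of ?S "V \<times> V \<times> V"]) auto
  have "card ?S = (\<Sum>x\<in>?S. 1)" by simp
  also have "\<dots> = (\<Sum>C\<in>?f ` ?S. \<Sum>x\<in>{x\<in>?S. ?f x = C}. 1)"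
    by (rule sum.image_gen[OF fS])
  also have "\<dots> = (\<Sum>C\<in>?f ` ?S. 3)"
  proof (intro sum.cong refl)
    fix C assume "C \<in> ?f ` ?S"
    then obtain p q r where pq: "p \<in> V" "q \<in> V" "r \<in> V" "tri (g p) (g q) (g r)"
      and C: "C = {p, q, r}" by auto
    have ne: "p \<noteq> q" "q \<noteq> r" "r \<noteq> p"
      using pq(4) cr_self by (auto simp: tri_def)
    \<comment> \<open>A transposition reverses the sign of some \<open>cr\<close>, so each positive
      triple arises from its three rotations only.\<close>
    have odd: "\<not> tri (g q) (g p) c" "\<not> tri (g r) (g q) c" "\<not> tri (g p) (g r) c" for c
      using pq(4) cr_swap[of "g p" "g q"] cr_swap[of "g q" "g r"] cr_swap[of "g r" "g p"]
      by (auto simp: tri_def)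
    have "x \<in> {(p,q,r), (q,r,p), (r,p,q)}" if "x \<in> ?S" "?f x = C" for x
    proof -
      obtain a b c where x: "x = (a,b,c)" by (cases x) auto
      have t: "tri (g a) (g b) (g c)" and eq: "{a,b,c} = {p,q,r}" using that x C by auto
      have abc: "a \<noteq> b" "b \<noteq> c" "c \<noteq> a" using t cr_self by (auto simp: tri_def)
      have "a \<in> {p,q,r}" "b \<in> {p,q,r}" "c \<in> {p,q,r}" using eq by auto
      then show ?thesis using abc odd t x by auto
    qed
    moreover have "{(p,q,r), (q,r,p), (r,p,q)} \<subseteq> {x\<in>?S. ?f x = C}"
      using pq C by (auto simp: tri_def)
    ultimately have "{x\<in>?S. ?f x = C} = {(p,q,r), (q,r,p), (r,p,q)}" by blast
    then show "(\<Sum>x\<in>{x\<in>?S. ?f x = C}. 1) = 3" using ne by simp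
  qed
  finally show ?thesis by (simp add: pos_triples_def)
qed

context config
begin

lemma tau_eq: "\<tau> = 3 * real (card (pos_triples V g))"
proof -
  have "\<tau> = (\<Sum>(p,q,r)\<in>V \<times> V \<times> V. of_bool (tri (g p) (g q) (g r)))"
    by (simp add: \<tau>_def sum.cartesian_product)
  also have "\<dots> = (\<Sum>x\<in>V \<times> V \<times> V. of_bool (case x of (p,q,r) \<Rightarrow> tri (g p) (g q) (g r)))"
    by (intro sum.cong refl) auto
  also have "\<dots> = real (card {(p,q,r) \<in> V \<times> V \<times> V. tri (g p) (g q) (g r)})"
    using fin by (subst sum_of_bool_eq) (auto intro!: arg_cong[of _ _ card])
  finally show ?thesis using card_pos_triples[OF fin, of g] by linarith
qed

lemma sum_y_eq: "(\<Sum>p\<in>V. y p) = 2 * real (card (opp_pairs V g))"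
proof -
  have "(\<Sum>p\<in>V. y p) = (\<Sum>(p,q)\<in>V \<times> V. of_bool (opp (g p) (g q)))"
    unfolding y_sum by (rule sum.cartesian_product)
  also have "\<dots> = (\<Sum>x\<in>V \<times> V. of_bool (case x of (p,q) \<Rightarrow> opp (g p) (g q)))"
    by (intro sum.cong refl) auto
  also have "\<dots> = real (card {(p,q) \<in> V \<times> V. opp (g p) (g q)})"
    using fin by (subst sum_of_bool_eq) (auto intro!: arg_cong[of _ _ card])
  finally show ?thesis using card_opp_pairs[OF fin, of g] by linarith
qed

lemma card_circuits: "card (circuits V g) = card (opp_pairs V g) + card (pos_triples V g)"
proof -
  have "card C = 2" if "C \<in> opp_pairs V g" for C
  proof -
    from that obtain p q where "opp (g p) (g q)" "C = {p,q}" by (auto simp: opp_pairs_def)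
    moreover from this have "p \<noteq> q" using opp_irrefl by auto
    ultimately show ?thesis by simp
  qed
  moreover have "card C = 3" if "C \<in> pos_triples V g" for C
  proof -
    from that obtain p q r where t: "tri (g p) (g q) (g r)" "C = {p,q,r}" by (auto simp: pos_triples_def)
    then have "p \<noteq> q" "q \<noteq> r" "r \<noteq> p" using cr_self by (auto simp: tri_def)
    then show ?thesis using t by simp
  qed
  ultimately have "opp_pairs V g \<inter> pos_triples V g = {}" by fastforce
  moreover have "finite (opp_pairs V g)" "finite (pos_triples V g)"
    by (rule finite_subset[of _ "Pow V"]; use fin in \<open>auto simp: opp_pairs_def pos_triples_def\<close>)+
  ultimately show ?thesis using circuits_eq[OF fin nz] by (simp add: card_Un_disjoint)
qed

text \<open>\<open>\<tau>\<close> counts every triple three times and the sum of \<open>y\<close>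
  counts every pair twice, so 24 circuits become \<open>8 * \<tau>\<close> plus 12 times that sum.
  Substituting \<open>y = (s - e) / 2\<close> produces the terms \<open>6 * s\<close> and the shift
  by 2 in the factor of \<open>e\<close>.\<close>

lemma excess_identity:
  "24 * (real (card (circuits V g)) - n) =
    (\<Sum>p\<in>V. n\<^sup>2 - 3 * n * s p + 2 * (s p)\<^sup>2 + 6 * s p - 24 - 3 * (D p)\<^sup>2 + 3 * (e p * (n - s p - 2)))"
proof -
  have "24 * (real (card (circuits V g)) - n) = 8 * \<tau> + 12 * (\<Sum>p\<in>V. y p) - 24 * n"
    by (simp add: tau_eq sum_y_eq card_circuits)
  also have "(\<Sum>p\<in>V. y p) = (\<Sum>p\<in>V. s p / 2 - e p / 2)"
    by (intro sum.cong refl) (simp add: e_eq field_simps)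
  finally have *: "24 * (real (card (circuits V g)) - n) = n^3 - 3 * n * (\<Sum>p\<in>V. s p)
     + 2 * (\<Sum>p\<in>V. (s p)\<^sup>2) - 3 * (\<Sum>p\<in>V. (D p)\<^sup>2)
     + 3 * (\<Sum>p\<in>V. e p * (n - s p)) + 12 * (\<Sum>p\<in>V. s p / 2 - e p / 2) - 24 * n"
    by (simp add: count_identity)
  have "n^3 = (\<Sum>p\<in>V. n\<^sup>2)" "24 * n = (\<Sum>p\<in>V. 24)"
    by (simp_all add: power3_eq_cube power2_eq_square)
  then show ?thesis unfolding *
    by (simp only: sum_distrib_left sum.distrib[symmetric] sum_subtractf[symmetric])
      (intro sum.cong refl, simp add: algebra_simps)
qed

lemma s_par:
  assumes "p \<in> V" "q \<in> V" "cr (g p) (g q) = 0"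
  shows "s q = s p"
proof -
  have "cr (g q) (g v) = 0 \<longleftrightarrow> cr (g p) (g v) = 0" if "v \<in> V" for v
    using par_trans[of "g p" "g q" "g v"] par_trans[of "g q" "g p" "g v"] assms that nz
      cr_swap[of "g p" "g q"] by auto
  then show ?thesis unfolding s_card by (metis (mono_tags, lifting) Collect_cong)
qed

lemma e_opp:
  assumes "p \<in> V" "q \<in> V" "opp (g p) (g q)"
  shows "e q = - e p"
proof -
  have c: "cr (g p) (g q) = 0" "orient (g p) (g q) = -1"
    using assms(3) by (auto simp: opp_def orient_def)
  have "orient (g q) (g v) = - orient (g p) (g v)" if "v \<in> V" for v
    using orient_mult[OF c(1), of "g v"] nz assms that c(2) by simp
  then show ?thesis unfolding e_def sum_negf[symmetric] by (intro sum.cong refl) auto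
qed

lemma s_ge1: "p \<in> V \<Longrightarrow> 1 \<le> s p"
proof -
  assume p: "p \<in> V"
  have "card {p} \<le> card {q\<in>V. cr (g p) (g q) = 0}"
    using fin p by (intro card_mono) auto
  then show ?thesis by (simp add: s_card)
qed

text \<open>Lines need not be formed as sets: \<open>s\<close> is constant along a line, and
  \<open>f (s p) * (e p)\<^sup>2 / s p\<close> is the equal share of each of its \<open>s p\<close>
  vectors in the line's total.\<close>

lemma sum_e_nonneg:
  assumes w: "\<And>p. p \<in> V \<Longrightarrow> 0 \<le> f (s p)"
  shows "0 \<le> (\<Sum>p\<in>V. e p * f (s p))"
proof -
  \<comment> \<open>\<open>\<psi>\<close> takes opposite values at opposite vectors, so subtracting it below does not change the sum
      but turns each summand into a square.\<close>
  define \<psi> where "\<psi> = (\<lambda>p. f (s p) * e p / s p)"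
  let ?o = "\<lambda>p q. of_bool (opp (g p) (g q)) :: real"
  have "(\<Sum>p\<in>V. \<Sum>q\<in>V. ?o p q * \<psi> p) = (\<Sum>q\<in>V. \<Sum>p\<in>V. ?o p q * \<psi> p)"
    by (rule sum.swap)
  also have "\<dots> = (\<Sum>q\<in>V. \<Sum>p\<in>V. - (?o q p * \<psi> q))"
  proof (intro sum.cong refl)
    fix p q assume "q \<in> V" "p \<in> V"
    then show "?o p q * \<psi> p = - (?o q p * \<psi> q)"
      using s_par[of q p] e_opp[of q p] opp_swap[of "g p" "g q"]
      by (auto simp: \<psi>_def opp_def)
  qed
  finally have "(\<Sum>p\<in>V. \<Sum>q\<in>V. ?o p q * \<psi> p) = 0" by (simp add: sum_negf)
  then have 0: "(\<Sum>p\<in>V. y p * \<psi> p) = 0" by (simp add: y_sum sum_distrib_right)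
  have "(\<Sum>p\<in>V. e p * f (s p)) = (\<Sum>p\<in>V. e p * f (s p) - 2 * (y p * \<psi> p))"
    using 0 by (simp add: sum_subtractf flip: sum_distrib_left)
  also have "\<dots> = (\<Sum>p\<in>V. f (s p) * (e p)\<^sup>2 / s p)"
  proof (intro sum.cong refl)
    fix p assume "p \<in> V"
    then have "s p > 0" using s_ge1 by fastforce
    moreover have "2 * (y p * \<psi> p) = (s p - e p) * \<psi> p" by (simp add: e_eq)
    ultimately show "e p * f (s p) - 2 * (y p * \<psi> p) = f (s p) * (e p)\<^sup>2 / s p"
      unfolding \<psi>_def by (simp add: field_simps power2_eq_square)
  qed
  also have "\<dots> \<ge> 0"
    using w s_ge1 by (intro sum_nonneg divide_nonneg_nonneg mult_nonneg_nonneg) force+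
  finally show ?thesis .
qed

lemma side_counts:
  "real (card {q\<in>V. 0 < cr (g p) (g q)}) + real (card {q\<in>V. cr (g p) (g q) < 0}) + s p = n"
  "D p = real (card {q\<in>V. 0 < cr (g p) (g q)}) - real (card {q\<in>V. cr (g p) (g q) < 0})"
proof -
  let ?P = "\<lambda>q. 0 < cr (g p) (g q)" and ?N = "\<lambda>q. cr (g p) (g q) < 0"
  have c: "real (card {q\<in>V. Q q}) = (\<Sum>q\<in>V. of_bool (Q q))" for Q
    using fin by (simp add: Int_def)
  have n: "n = (\<Sum>q\<in>V. 1)" by simp
  show "real (card {q\<in>V. ?P q}) + real (card {q\<in>V. ?N q}) + s p = n"
    unfolding c s_card n sum.distrib[symmetric] by (intro sum.cong refl) auto
  show "D p = real (card {q\<in>V. ?P q}) - real (card {q\<in>V. ?N q})"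
    unfolding c D_def sum_subtractf[symmetric]
    by (intro sum.cong refl) (auto simp: sg_def sgn_if)
qed

text \<open>The two open sides of the line through \<open>p\<close> hold \<open>n - s p\<close>
  vectors together and at least \<open>K\<close> each.\<close>

lemma D_bound:
  assumes H: "half_planes K V g" and p: "p \<in> V"
  shows "\<bar>D p\<bar> \<le> n - s p - 2 * real K" "s p \<le> n - 2 * real K"
proof -
  have "K \<le> card {q\<in>V. 0 < (\<i> * g p) \<bullet> g q}" "K \<le> card {q\<in>V. 0 < (\<i> * (- g p)) \<bullet> g q}"
    using H nz[OF p] unfolding half_planes_def by (metis mult_eq_0_iff complex_i_not_zero neg_equal_0_iff_equal)+
  then have K: "K \<le> card {q\<in>V. 0 < cr (g p) (g q)}" "K \<le> card {q\<in>V. cr (g p) (g q) < 0}"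
    unfolding inner_ii by (simp_all add: cr_def)
  then show "\<bar>D p\<bar> \<le> n - s p - 2 * real K" "s p \<le> n - 2 * real K"
    using side_counts[of p] by linarith+
qed

lemma excess_bound:
  assumes H: "half_planes K V g" and K: "3 \<le> K" and n4: "card V \<le> 4 * K"
  shows "n * (4 * (real K)\<^sup>2 - 6 * real K - 12 - n * (real K - 3))
    \<le> 12 * (real (card (circuits V g)) - n)"
proof -
  let ?k = "real K"
  let ?b = "2 * (4 * ?k\<^sup>2 - 6 * ?k - 12 - n * (?k - 3))"
  \<comment> \<open>The weight is nonnegative because \<open>s p\<close> is at most
    \<open>n - 2 * K\<close> and \<open>K\<close> is at least 3.\<close>
  have e0: "0 \<le> (\<Sum>p\<in>V. e p * (n - s p - 2))"
    using D_bound(2)[OF H] K by (intro sum_e_nonneg[of "\<lambda>x. n - x - 2"]) fastforce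
  have "2 * (n * (4 * ?k\<^sup>2 - 6 * ?k - 12 - n * (?k - 3))) = (\<Sum>p\<in>V. ?b)"
    by (simp add: algebra_simps)
  also have "\<dots> \<le> (\<Sum>p\<in>V. n\<^sup>2 - 3 * n * s p + 2 * (s p)\<^sup>2 + 6 * s p - 24 - 3 * (D p)\<^sup>2)"
  proof (rule sum_mono)
    fix p assume p: "p \<in> V"
    have "(D p)\<^sup>2 \<le> (n - s p - 2 * ?k)\<^sup>2"
      using D_bound(1)[OF H p] by (metis abs_ge_zero power2_abs power_mono)
    \<comment> \<open>With \<open>(D p)\<^sup>2\<close> replaced by its bound, the difference
      between the summand and \<open>?b\<close> is exactly this product; it vanishes at
      \<open>s p = n - 2 * K\<close>. The second factor is at least \<open>2 * K - 5\<close>, by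
      \<open>n4\<close> and \<open>1 \<le> s p\<close>.\<close>
    moreover have "0 \<le> (n - 2 * ?k - s p) * (10 * ?k - 2 * n - 6 + s p)"
      using D_bound(2)[OF H p] s_ge1[OF p] K n4 by (intro mult_nonneg_nonneg) auto
    ultimately show "?b \<le> n\<^sup>2 - 3 * n * s p + 2 * (s p)\<^sup>2 + 6 * s p - 24 - 3 * (D p)\<^sup>2"
      by (simp add: power2_eq_square algebra_simps)
  qed
  also have "\<dots> \<le> \<dots> + 3 * (\<Sum>p\<in>V. e p * (n - s p - 2))" using e0 by simp
  also have "\<dots> = 24 * (real (card (circuits V g)) - n)"
    unfolding excess_identity by (simp add: sum.distrib sum_distrib_left)
  finally show ?thesis by linarith
qed

end

subsection \<open>Deleting vectors\<close>

text \<open>Take \<open>p\<close> of least value among the elements with at least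
  \<open>K + 1\<close> values at or below their own. If more than \<open>K\<close> values were
  strictly below \<open>f p\<close>, the largest of them would belong to a smaller such
  element.\<close>

lemma median:
  fixes f :: "'a \<Rightarrow> real"
  assumes fin: "finite U" and card: "2 * K + 1 \<le> card U"
  obtains p where "p \<in> U" "K + 1 \<le> card {u\<in>U. f u \<le> f p}" "K + 1 \<le> card {u\<in>U. f p \<le> f u}"
proof -
  define S where "S = {p\<in>U. K + 1 \<le> card {u\<in>U. f u \<le> f p}}"
  have neU: "U \<noteq> {}" using card by auto
  have fS: "finite S" using fin by (simp add: S_def)
  obtain m where m: "m \<in> U" "\<And>u. u \<in> U \<Longrightarrow> f u \<le> f m"
    using arg_min_if_finite(1)[OF fin neU, of "\<lambda>u. - f u"] arg_min_least[OF fin neU, of _ "\<lambda>u. - f u"]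
    by (metis neg_le_iff_le)
  have "{u\<in>U. f u \<le> f m} = U" using m by auto
  then have "m \<in> S" using m card by (simp add: S_def)
  then obtain p where p: "p \<in> S" and pmin: "\<And>q. q \<in> S \<Longrightarrow> f p \<le> f q"
    using arg_min_if_finite(1)[OF fS, of f] arg_min_least[OF fS, of _ f] by blast
  define L where "L = {u\<in>U. f u < f p}"
  have "card L \<le> K"
  proof (cases "L = {}")
    case False
    have "finite L" using fin by (simp add: L_def)
    then obtain q where q: "q \<in> L" "\<And>u. u \<in> L \<Longrightarrow> f u \<le> f q"
      using arg_min_if_finite(1)[OF _ False, of "\<lambda>u. - f u"] arg_min_least[OF _ False, of _ "\<lambda>u. - f u"]
      by (metis neg_le_iff_le)
    then have L: "L = {u\<in>U. f u \<le> f q}" by (auto simp: L_def)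
    have "q \<notin> S" "q \<in> U" using pmin[of q] q by (auto simp: L_def)
    then have "card {u\<in>U. f u \<le> f q} \<le> K" by (simp add: S_def)
    then show ?thesis by (simp only: L)
  qed simp
  moreover have "card U = card L + card {u\<in>U. f p \<le> f u}"
    unfolding L_def using fin by (subst card_Un_disjoint[symmetric]) (auto intro!: arg_cong[of _ _ card])
  ultimately have "K + 1 \<le> card {u\<in>U. f p \<le> f u}" using card by linarith
  then show ?thesis using that p by (auto simp: S_def)
qed

text \<open>In the closed upper half-plane the ratio \<open>x / (\<bar>x\<bar> + y)\<close>, a
  cosine for the l1 norm, decreases with the angle and, unlike the cotangent, is defined on the
  boundary too. For \<open>\<alpha> > 0\<close> the open half-plane of the functional contains, with
  a point, every point at a smaller angle.\<close>

lemma arc_monotone: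
  fixes a b c d \<alpha> \<beta> :: real
  assumes "0 \<le> b" "0 \<le> d" "0 < \<bar>a\<bar> + b" "0 < \<bar>c\<bar> + d" and \<alpha>: "0 < \<alpha>"
    and ord: "c / (\<bar>c\<bar> + d) \<le> a / (\<bar>a\<bar> + b)" and f: "0 < \<alpha> * c + \<beta> * d"
  shows "0 < \<alpha> * a + \<beta> * b"
proof -
  have o: "c * (\<bar>a\<bar> + b) \<le> a * (\<bar>c\<bar> + d)" using assms(3,4) ord by (simp add: field_simps)
  \<comment> \<open>The cases remove the absolute values: for \<open>a\<close> and \<open>c\<close>
    of equal sign the order condition \<open>o\<close> becomes
    \<open>c * b \<le> a * d\<close>.\<close>
  consider "0 < c" | "c = 0" | "c < 0" "0 \<le> a" | "c < 0" "a < 0" by linarith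
  then show ?thesis
  proof cases
    case 1
    have a: "0 \<le> a"
    proof (rule ccontr)
      assume "\<not> 0 \<le> a"
      then have "a * (\<bar>c\<bar> + d) < 0" using assms(4) by (simp add: mult_neg_pos)
      moreover have "0 < c * (\<bar>a\<bar> + b)" using 1 assms(3) by simp
      ultimately show False using o by linarith
    qed
    then have o': "c * b \<le> a * d" using o 1 by (simp add: algebra_simps)
    have "0 < a"
    proof (rule ccontr)
      assume "\<not> 0 < a"
      with a have "a = 0" by simp
      with o' 1 assms(1,3) show False by (simp add: mult_le_0_iff)
    qed
    show ?thesis
    proof (cases "0 \<le> \<beta>")
      case True
      then show ?thesis using \<open>0 < a\<close> \<alpha> assms(1) by (simp add: add_pos_nonneg)
    next
      case False
      then have "\<beta> * (a * d) \<le> \<beta> * (c * b)" using o' by (simp add: mult_left_mono_neg)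
      then have "a * (\<alpha> * c + \<beta> * d) \<le> c * (\<alpha> * a + \<beta> * b)" by (simp add: algebra_simps)
      moreover have "0 < a * (\<alpha> * c + \<beta> * d)" using \<open>0 < a\<close> f by simp
      ultimately show ?thesis using 1 by (metis less_le_trans zero_less_mult_pos)
    qed
  next
    case 2
    then have "0 < \<beta>" using f assms(2) by (simp add: zero_less_mult_iff)
    moreover have "0 \<le> a" using o 2 assms(2,4) by (simp add: zero_le_mult_iff)
    ultimately show ?thesis using \<alpha> assms(1,3)
      by (cases "a = 0") (simp_all add: add_pos_nonneg)
  next
    case 3
    then have "0 < \<beta> * d" using f \<alpha> mult_pos_neg[of \<alpha> c] by linarith
    then have "0 < \<beta>" using assms(2) by (simp add: zero_less_mult_iff)
    then show ?thesis using \<alpha> assms(1,3) 3(2)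
      by (cases "a = 0") (simp_all add: add_pos_nonneg)
  next
    case 4
    then have "0 < \<beta> * d" using f \<alpha> mult_pos_neg[of \<alpha> c] by linarith
    then have \<beta>: "0 < \<beta>" using assms(2) by (simp add: zero_less_mult_iff)
    have "- a * d \<le> - c * b" using o 4 by (simp add: algebra_simps)
    then have "\<beta> * (- a * d) \<le> \<beta> * (- c * b)" using \<beta> by (simp add: mult_left_mono)
    then have "- a * (\<alpha> * c + \<beta> * d) \<le> - c * (\<alpha> * a + \<beta> * b)" by (simp add: algebra_simps)
    moreover have "0 < - a * (\<alpha> * c + \<beta> * d)" using 4 f by (simp add: mult_neg_pos)
    ultimately show ?thesis using 4(1) by (metis less_le_trans neg_0_less_iff_less zero_less_mult_pos)
  qed
qed

lemma half_planes_remove: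
  assumes H: "half_planes K V g" and fin: "finite V"
    and p: "\<And>z. 0 < z \<bullet> g p \<Longrightarrow> K + 1 \<le> card {v\<in>V. 0 < z \<bullet> g v}"
  shows "half_planes K (V - {p}) g"
  unfolding half_planes_def
proof (intro allI impI)
  fix z :: complex assume z: "z \<noteq> 0"
  have *: "{v\<in>V - {p}. 0 < z \<bullet> g v} = {v\<in>V. 0 < z \<bullet> g v} - {p}" by auto
  show "K \<le> card {v\<in>V - {p}. 0 < z \<bullet> g v}"
  proof (cases "0 < z \<bullet> g p")
    case True
    then show ?thesis using p[OF True] fin unfolding * by (auto simp: card_Diff_singleton_if)
  next
    case False
    then have "{v\<in>V. 0 < z \<bullet> g v} - {p} = {v\<in>V. 0 < z \<bullet> g v}" by auto
    then show ?thesis using H z unfolding * half_planes_def by simp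
  qed
qed

context config
begin

text \<open>Choose a half-plane with exactly \<open>K\<close> vectors and order the complementary closed half-plane
  by angle; \<open>m v\<close> normalizes \<open>v\<close> so that \<open>w \<bullet> g v / m v\<close> is monotone in the angle.  An open
  half-plane containing the median contains everything on one of its sides.\<close>

lemma removable:
  assumes H: "half_planes K V g" and card: "4 * K < card V"
  shows "\<exists>p\<in>V. half_planes K (V - {p}) g"
proof (cases "\<exists>z. z \<noteq> 0 \<and> card {v\<in>V. 0 < z \<bullet> g v} = K")
  case False
  obtain p where "p \<in> V" using card by fastforce
  moreover have "half_planes K (V - {p}) g"
  proof (rule half_planes_remove[OF H fin])
    fix z :: complex assume "0 < z \<bullet> g p"
    then have "z \<noteq> 0" by auto
    with H False have "K \<le> card {v\<in>V. 0 < z \<bullet> g v}" "card {v\<in>V. 0 < z \<bullet> g v} \<noteq> K"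
      unfolding half_planes_def by auto
    then show "K + 1 \<le> card {v\<in>V. 0 < z \<bullet> g v}" by simp
  qed
  ultimately show ?thesis by blast
next
  case True
  then obtain z1 :: complex where z1: "z1 \<noteq> 0" "card {v\<in>V. 0 < z1 \<bullet> g v} = K" by blast
  define U where "U = {v\<in>V. z1 \<bullet> g v \<le> 0}"
  define N where "N = {v\<in>V. z1 \<bullet> g v < 0}"
  define B where "B = {v\<in>V. z1 \<bullet> g v = 0}"
  have "card V = card {v\<in>V. 0 < z1 \<bullet> g v} + card U"
    unfolding U_def using fin by (subst card_Un_disjoint[symmetric]) (auto intro!: arg_cong[of _ _ card])
  then have cU: "3 * K < card U" using z1 card by simp
  have fU: "finite U" using fin by (simp add: U_def)
  have UN: "card U = card N + card B"
    unfolding U_def N_def B_def using fin by (subst card_Un_disjoint[symmetric]) (auto intro!: arg_cong[of _ _ card])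
  define w where "w = \<i> * z1"
  have decomp: "(z1 \<bullet> z1) * (z \<bullet> v) = (z \<bullet> w) * (w \<bullet> v) + (z \<bullet> z1) * (z1 \<bullet> v)" for z v
    unfolding w_def inner_complex_eq by (simp add: algebra_simps)
  have zz: "0 < z1 \<bullet> z1" using z1 by simp
  have wz: "w \<bullet> g v \<noteq> 0" if "v \<in> B" for v
  proof
    assume "w \<bullet> g v = 0"
    then have "(z1 \<bullet> z1) * (g v \<bullet> g v) = 0" using that unfolding decomp by (simp add: B_def)
    then show False using zz nz that by (simp add: B_def)
  qed
  show ?thesis
  \<comment> \<open>The median argument fails for \<open>z\<close> parallel to \<open>z1\<close>,
    where the half-plane containing \<open>p\<close> holds only the vectors of \<open>N\<close>
    within \<open>U\<close>. If \<open>N\<close> has at most \<open>K\<close> elements, more than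
    \<open>2 * K\<close> vectors lie on the boundary line, and one of its two rays carries at least
    \<open>K + 1\<close>. A half-plane containing one vector of a ray contains them all, so any of
    these can go.\<close>
  proof (cases "K < card N")
    case False
    define P where "P = {v\<in>B. 0 < w \<bullet> g v}"
    define M where "M = {v\<in>B. w \<bullet> g v < 0}"
    have fB: "finite B" using fin by (simp add: B_def)
    have "B = P \<union> M" "P \<inter> M = {}" using wz unfolding P_def M_def by force+
    then have "card B = card P + card M" using fB by (metis card_Un_disjoint finite_Un)
    then have "K + 1 \<le> card P \<or> K + 1 \<le> card M" using False UN cU by linarith
    then obtain R \<epsilon> where R: "R = {v\<in>B. 0 < \<epsilon> * (w \<bullet> g v)}" "K + 1 \<le> card R"
      using that[of P 1] that[of M "-1"] unfolding P_def M_def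
      by (metis (no_types, lifting) Collect_cong mult_1 mult_minus1 neg_0_less_iff_less)
    have "R \<noteq> {}"
    proof
      assume "R = {}"
      with R(2) show False by simp
    qed
    then obtain p where p: "p \<in> R" by blast
    have "half_planes K (V - {p}) g"
    proof (rule half_planes_remove[OF H fin])
      fix z assume z: "0 < z \<bullet> g p"
      have "R \<subseteq> {v\<in>V. 0 < z \<bullet> g v}"
      proof
        fix v assume v: "v \<in> R"
        have eq: "(z1 \<bullet> z1) * (z \<bullet> g v) = (z \<bullet> w) * (w \<bullet> g v)" if "v \<in> R" for v
          using decomp[of z "g v"] that R by (simp add: B_def)
        have "0 < (z1 \<bullet> z1) * (z \<bullet> g p)" using zz z by simp
        then have "0 < (z \<bullet> w) * (w \<bullet> g p)" using eq[OF p] by simp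
        moreover have "0 < \<epsilon> * (w \<bullet> g p)" "0 < \<epsilon> * (w \<bullet> g v)" using R p v by auto
        ultimately have "0 < (z \<bullet> w) * (w \<bullet> g v)"
          by (auto simp: zero_less_mult_iff)
        then have "0 < (z1 \<bullet> z1) * (z \<bullet> g v)" using eq[OF v] by simp
        then show "v \<in> {v\<in>V. 0 < z \<bullet> g v}" using zz v R by (simp add: zero_less_mult_iff B_def)
      qed
      then show "K + 1 \<le> card {v\<in>V. 0 < z \<bullet> g v}"
        using R(2) card_mono[of "{v\<in>V. 0 < z \<bullet> g v}" R] fin by simp
    qed
    then show ?thesis using p R by (auto simp: B_def)
  next
    case N: True
    define m where "m = (\<lambda>v. \<bar>w \<bullet> g v\<bar> + (- (z1 \<bullet> g v)))"
    have mpos: "0 < m v" if "v \<in> U" for v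
      using wz[of v] that by (cases "v \<in> B") (auto simp: m_def U_def B_def)
    obtain p where p: "p \<in> U" and le: "K + 1 \<le> card {u\<in>U. w \<bullet> g u / m u \<le> w \<bullet> g p / m p}"
      and ge: "K + 1 \<le> card {u\<in>U. w \<bullet> g p / m p \<le> w \<bullet> g u / m u}"
      using median[OF fU, of K "\<lambda>u. w \<bullet> g u / m u"] cU by force
    have "half_planes K (V - {p}) g"
    proof (rule half_planes_remove[OF H fin])
      fix z assume z: "0 < z \<bullet> g p"
      have eq: "(z1 \<bullet> z1) * (z \<bullet> g v) = (z \<bullet> w) * (w \<bullet> g v) + (- (z \<bullet> z1)) * (- (z1 \<bullet> g v))" for v
        using decomp[of z "g v"] by simp
      have fp: "0 < (z \<bullet> w) * (w \<bullet> g p) + (- (z \<bullet> z1)) * (- (z1 \<bullet> g p))"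
        using eq[of p] z zz by (metis mult_pos_pos)
      have pos: "0 < z \<bullet> g v" if "0 < (z \<bullet> w) * (w \<bullet> g v) + (- (z \<bullet> z1)) * (- (z1 \<bullet> g v))" for v
        using that zz unfolding eq[symmetric] by (simp add: zero_less_mult_iff)
      have "\<exists>S \<subseteq> U. K + 1 \<le> card S \<and> (\<forall>v\<in>S. 0 < z \<bullet> g v)"
      proof -
        consider "0 < z \<bullet> w" | "z \<bullet> w < 0" | "z \<bullet> w = 0" by linarith
        then show ?thesis
        proof cases
          case 1
          have "0 < z \<bullet> g u" if "u \<in> U" "w \<bullet> g p / m p \<le> w \<bullet> g u / m u" for u
            using that p mpos by (intro pos arc_monotone[OF _ _ _ _ 1 _ fp]) (auto simp: U_def m_def)
          then show ?thesis using ge by (intro exI[of _ "{u\<in>U. w \<bullet> g p / m p \<le> w \<bullet> g u / m u}"]) auto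
        next
          case 2
          have "0 < z \<bullet> g u" if "u \<in> U" "w \<bullet> g u / m u \<le> w \<bullet> g p / m p" for u
          proof -
            \<comment> \<open>Reflecting the coordinate along \<open>w\<close> reverses the angular
              order and makes the coefficient of that coordinate positive.\<close>
            have "0 < (- (z \<bullet> w)) * (- (w \<bullet> g u)) + (- (z \<bullet> z1)) * (- (z1 \<bullet> g u))"
            proof (rule arc_monotone)
              show "- (w \<bullet> g p) / (\<bar>- (w \<bullet> g p)\<bar> + - (z1 \<bullet> g p)) \<le> - (w \<bullet> g u) / (\<bar>- (w \<bullet> g u)\<bar> + - (z1 \<bullet> g u))"
                using that(2) by (simp add: m_def)
              show "0 < - (z \<bullet> w) * - (w \<bullet> g p) + - (z \<bullet> z1) * - (z1 \<bullet> g p)" using fp by simp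
              show "0 < \<bar>- (w \<bullet> g u)\<bar> + - (z1 \<bullet> g u)" "0 < \<bar>- (w \<bullet> g p)\<bar> + - (z1 \<bullet> g p)"
                using mpos[OF that(1)] mpos[OF p] by (simp_all add: m_def)
            qed (use that p 2 in \<open>auto simp: U_def\<close>)
            then show ?thesis by (intro pos) simp
          qed
          then show ?thesis using le by (intro exI[of _ "{u\<in>U. w \<bullet> g u / m u \<le> w \<bullet> g p / m p}"]) auto
        next
          case 3
          \<comment> \<open>Here \<open>z\<close> is a negative multiple of \<open>z1\<close>, so
            its half-plane contains all of \<open>N\<close>.\<close>
          have "0 < - (z \<bullet> z1)" using fp 3 p by (auto simp: U_def zero_less_mult_iff)
          then have "0 < z \<bullet> g u" if "u \<in> N" for u
            using that 3 by (intro pos) (simp add: N_def mult_neg_neg)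
          moreover have "N \<subseteq> U" by (auto simp: N_def U_def)
          ultimately show ?thesis using N by (intro exI[of _ N]) auto
        qed
      qed
      then obtain S where S: "S \<subseteq> U" "K + 1 \<le> card S" "\<forall>v\<in>S. 0 < z \<bullet> g v" by blast
      have "S \<subseteq> {v\<in>V. 0 < z \<bullet> g v}" using S by (auto simp: U_def)
      then show "K + 1 \<le> card {v\<in>V. 0 < z \<bullet> g v}"
        using S(2) card_mono[of "{v\<in>V. 0 < z \<bullet> g v}" S] fin by simp
    qed
    then show ?thesis using p by (auto simp: U_def)
  qed
qed

end

section \<open>Reduction to few nonzero vectors\<close>

lemma finite_circuits: "finite V \<Longrightarrow> finite (circuits V g)"
  by (rule finite_subset[of _ "Pow V"]) (auto simp: circuits_def)

lemma circuits_mono: "W \<subseteq> V \<Longrightarrow> circuits W g \<subseteq> circuits V g"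
  by (auto simp: circuits_def)

text \<open>Serves twice: deleting a vector destroys a circuit, and every vertex outside a small set
  lies in a circuit avoiding that set.\<close>

lemma half_planes_circuit:
  assumes H: "half_planes K V g" and K: "0 < K" and fin: "finite V" and p: "p \<in> V"
  shows "\<exists>C\<in>circuits V g. p \<in> C"
proof (cases "g p = 0")
  case True
  then show ?thesis using pos_circuit_singleton[of g p] p by (auto simp: circuits_def)
next
  case False
  have "\<exists>r\<in>V. 0 < z \<bullet> g r" if "z \<bullet> g v < 0" for z v
  proof -
    have "z \<noteq> 0" using that by auto
    then have "0 < card {v\<in>V. 0 < z \<bullet> g v}" using H K unfolding half_planes_def by (meson less_le_trans)
    then show ?thesis by (auto simp: card_gt_0_iff)
  qed
  then have "(\<exists>q\<in>V. opp (g p) (g q)) \<or> (\<exists>q\<in>V. \<exists>r\<in>V. tri (g p) (g q) (g r))"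
    by (rule circuit_through[where g = g, OF fin p False])
  then show ?thesis
  proof
    assume "\<exists>q\<in>V. opp (g p) (g q)"
    then obtain q where "q \<in> V" "opp (g p) (g q)" by blast
    then show ?thesis using pos_circuit_pair[of g p q] p by (intro bexI[of _ "{p,q}"]) (auto simp: circuits_def)
  next
    assume "\<exists>q\<in>V. \<exists>r\<in>V. tri (g p) (g q) (g r)"
    then obtain q r where "q \<in> V" "r \<in> V" "tri (g p) (g q) (g r)" by blast
    then show ?thesis using pos_circuit_triple[of g p q r] p by (intro bexI[of _ "{p,q,r}"]) (auto simp: circuits_def)
  qed
qed

lemma card_circuits_remove:
  assumes H: "half_planes K V g" and K: "0 < K" and fin: "finite V" and p: "p \<in> V"
  shows "card (circuits (V - {p}) g) + 1 \<le> card (circuits V g)"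
proof -
  obtain C where C: "C \<in> circuits V g" "p \<in> C" using half_planes_circuit[OF assms] by blast
  then have "insert C (circuits (V - {p}) g) \<subseteq> circuits V g" "C \<notin> circuits (V - {p}) g"
    using circuits_mono[of "V - {p}" V g] by (auto simp: circuits_def)
  then show ?thesis
    using card_mono[OF finite_circuits[OF fin], of "insert C (circuits (V - {p}) g)"] finite_circuits[of "V - {p}" g] fin by simp
qed

text \<open>Each deletion costs one vector and at least one circuit, so circuits minus vectors never
  increases; the inequality is written additively to avoid subtraction of naturals.\<close>

lemma small_subconfig:
  assumes "finite V" "half_planes K V g" "0 < K" "\<And>v. v \<in> V \<Longrightarrow> g v \<noteq> 0"
  shows "\<exists>W\<subseteq>V. half_planes K W g \<and> card W \<le> 4 * K \<and>
    card (circuits W g) + card V \<le> card (circuits V g) + card W"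
  using assms
proof (induction "card V" arbitrary: V rule: less_induct)
  case less
  show ?case
  proof (cases "card V \<le> 4 * K")
    case True
    then show ?thesis using less.prems by (intro exI[of _ V]) auto
  next
    case False
    interpret config V g by unfold_locales (use less.prems in blast)+
    obtain p where p: "p \<in> V" "half_planes K (V - {p}) g"
      using removable[OF less.prems(2)] False by auto
    have c: "card (V - {p}) < card V" "card V = card (V - {p}) + 1"
      using card_Diff1_less[OF fin p(1)] card_Suc_Diff1[OF fin p(1)] by simp_all
    have "\<exists>W\<subseteq>V - {p}. half_planes K W g \<and> card W \<le> 4 * K \<and>
        card (circuits W g) + card (V - {p}) \<le> card (circuits (V - {p}) g) + card W"
    proof (rule less.hyps[OF c(1) _ p(2) less.prems(3)])
      show "finite (V - {p})" using fin by simp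
      show "g v \<noteq> 0" if "v \<in> V - {p}" for v using that nz by blast
    qed
    then obtain W where W: "W \<subseteq> V - {p}" "half_planes K W g" "card W \<le> 4 * K"
      "card (circuits W g) + card (V - {p}) \<le> card (circuits (V - {p}) g) + card W"
      by blast
    have "card (circuits (V - {p}) g) + 1 \<le> card (circuits V g)"
      by (rule card_circuits_remove[OF less.prems(2,3,1) p(1)])
    then show ?thesis using W c(2) by (intro exI[of _ W]) auto
  qed
qed

text \<open>Each zero vector is a circuit by itself, so removing it lowers both counts by at least
  one and the vector count by exactly one.\<close>

lemma drop_zeros:
  fixes V :: "'a set" and g :: "'a \<Rightarrow> complex"
  assumes fin: "finite V"
  defines "W \<equiv> {v\<in>V. g v \<noteq> 0}"
  shows "half_planes K V g \<Longrightarrow> half_planes K W g"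
    and "card (circuits W g) + card V \<le> card (circuits V g) + card W"
proof -
  have "{v\<in>W. 0 < z \<bullet> g v} = {v\<in>V. 0 < z \<bullet> g v}" for z by (auto simp: W_def)
  then show "half_planes K V g \<Longrightarrow> half_planes K W g" by (simp add: half_planes_def)
  let ?Z = "{v\<in>V. g v = 0}"
  have "{v} \<in> circuits V g" if "v \<in> ?Z" for v
    using that pos_circuit_singleton[of g v] by (simp add: circuits_def)
  moreover have "circuits W g \<subseteq> circuits V g"
    by (rule circuits_mono) (auto simp: W_def)
  ultimately have "circuits W g \<union> (\<lambda>v. {v}) ` ?Z \<subseteq> circuits V g" by blast
  then have "card (circuits W g \<union> (\<lambda>v. {v}) ` ?Z) \<le> card (circuits V g)"
    by (rule card_mono[OF finite_circuits[OF fin]])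
  moreover have "card (circuits W g \<union> (\<lambda>v. {v}) ` ?Z) = card (circuits W g) + card ((\<lambda>v. {v}) ` ?Z)"
    using fin finite_circuits[of W g] by (intro card_Un_disjoint) (auto simp: W_def circuits_def)
  moreover have "card ((\<lambda>v. {v}) ` ?Z) = card ?Z" by (intro card_image) auto
  moreover have "card V = card W + card ?Z"
    unfolding W_def using fin by (subst card_Un_disjoint[symmetric]) (auto intro!: arg_cong[of _ _ card])
  ultimately show "card (circuits W g) + card V \<le> card (circuits V g) + card W" by simp
qed

section \<open>The lower bound for planar configurations\<close>

definition target :: "nat \<Rightarrow> int" where
  "target k = (if k = 2 then 4 else if k = 3 then 15 else 2 * ((int k)\<^sup>2 - 1))"

lemma circuits_lower_bound:
  assumes fin: "finite V" and H: "half_planes (k + 1) V g" and k: "2 \<le> k"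
  shows "target k \<le> int (card (circuits V g)) - int (card V)"
proof -
  define W0 where "W0 = {v\<in>V. g v \<noteq> 0}"
  have W0: "half_planes (k + 1) W0 g" "card (circuits W0 g) + card V \<le> card (circuits V g) + card W0"
    using drop_zeros(1)[OF fin H] drop_zeros(2)[OF fin, of g] unfolding W0_def by simp_all
  have "\<exists>W\<subseteq>W0. half_planes (k + 1) W g \<and> card W \<le> 4 * (k + 1) \<and>
      card (circuits W g) + card W0 \<le> card (circuits W0 g) + card W"
    by (rule small_subconfig) (use W0 fin in \<open>auto simp: W0_def\<close>)
  then obtain W where W: "W \<subseteq> W0" "half_planes (k + 1) W g" "card W \<le> 4 * (k + 1)"
    "card (circuits W g) + card W0 \<le> card (circuits W0 g) + card W"
    by blast
  interpret config W g
  proof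
    show "finite W" using W(1) fin by (auto simp: W0_def intro: finite_subset)
    show "\<And>v. v \<in> W \<Longrightarrow> g v \<noteq> 0" using W(1) by (auto simp: W0_def)
  qed
  have "k + 1 \<le> card {v\<in>W. 0 < 1 \<bullet> g v}"
    by (rule W(2)[unfolded half_planes_def, rule_format, OF one_neq_zero])
  then have "0 < card {v\<in>W. 0 < 1 \<bullet> g v}" by linarith
  then obtain p where p: "p \<in> W" unfolding card_gt_0_iff by blast
  let ?K = "real (k + 1)"
  define F where "F = int (card (circuits W g)) - int (card W)"
  have n1: "2 * ?K + 1 \<le> n" using D_bound(2)[OF W(2) p] s_ge1[OF p] by linarith
  have n2: "n \<le> 4 * ?K" using W(3) by linarith
  have bound: "n * (4 * ?K\<^sup>2 - 6 * ?K - 12 - n * (?K - 3)) \<le> 12 * real_of_int F"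
    using excess_bound[OF W(2)] W(3) k unfolding F_def by simp
  \<comment> \<open>A strict inequality one below the target suffices for integers; for
    \<open>k = 2\<close> and \<open>k = 3\<close> the real estimate does not reach the target
    itself.\<close>
  have "target k - 1 < F"
  proof -
    consider "k = 2" | "k = 3" | "4 \<le> k" using k by linarith
    then show ?thesis
    proof cases
      case 1
      then have "36 < 12 * real_of_int F" using bound n1 by simp
      then show ?thesis using 1 by (simp add: target_def)
    next
      case 2
      then have b: "n * (28 - n) \<le> 12 * real_of_int F" using bound by simp
      \<comment> \<open>Nonnegative between the endpoints 9 and 16; it replaces
        \<open>n * (28 - n)\<close> by its chord \<open>144 + 3 * n\<close>, which is at least
        171.\<close>
      have "0 \<le> (n - 9) * (16 - n)" using n1 n2 2 by (intro mult_nonneg_nonneg) auto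
      then have "168 < 12 * real_of_int F" using b n1 2 by (simp add: algebra_simps)
      then show ?thesis using 2 by (simp add: target_def)
    next
      case 3
      \<comment> \<open>The excess of the bound over its value at \<open>n = 4 * K\<close> splits
        into a concave part vanishing at both endpoints and the chord, which vanishes at
        \<open>4 * K\<close>. The chord is nonnegative because \<open>4 \<le> k\<close> makes
        \<open>2 * K - 9\<close> positive.\<close>
      have "0 \<le> (n - (2 * ?K + 1)) * (4 * ?K - n) * (?K - 3)"
        using n1 n2 3 by (intro mult_nonneg_nonneg) auto
      moreover have "0 \<le> (4 * ?K - n) * (?K - 1) * (2 * ?K - 9)"
        using n2 3 by (intro mult_nonneg_nonneg) auto
      moreover have "n * (4 * ?K\<^sup>2 - 6 * ?K - 12 - n * (?K - 3)) - 24 * ?K * (?K - 2) =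
          (n - (2 * ?K + 1)) * (4 * ?K - n) * (?K - 3) + (4 * ?K - n) * (?K - 1) * (2 * ?K - 9)"
        by algebra
      ultimately have "24 * ?K * (?K - 2) \<le> 12 * real_of_int F" using bound by linarith
      then have "2 * ?K * (?K - 2) \<le> real_of_int F" by linarith
      also have "2 * ?K * (?K - 2) = real_of_int (2 * ((int k)\<^sup>2 - 1))"
        by (simp add: power2_eq_square algebra_simps)
      finally have "2 * ((int k)\<^sup>2 - 1) \<le> F" by linarith
      then show ?thesis using 3 by (simp add: target_def)
    qed
  qed
  then show ?thesis using W(4) W0(2) unfolding F_def by linarith
qed

subsection \<open>Affine functionals and faces\<close>

text \<open>No inner product is assumed on the ambient space, so supporting hyperplanes are given by
  affine functionals.\<close>

definition affine_fun :: "('a::real_vector \<Rightarrow> real) \<Rightarrow> bool" where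
  "affine_fun f \<longleftrightarrow> (\<exists>L t. linear L \<and> f = (\<lambda>x. L x + t))"

lemma affine_fun_weighted:
  assumes "affine_fun f"
  obtains L t where "linear L" "\<And>x. f x = L x + t"
    "\<And>u (S::'a::real_vector set). (\<Sum>v\<in>S. u v * f v) = L (\<Sum>v\<in>S. u v *\<^sub>R v) + t * sum u S"
proof -
  from assms obtain L t where L: "linear L" "f = (\<lambda>x. L x + t)" unfolding affine_fun_def by blast
  have "(\<Sum>v\<in>S. u v * f v) = L (\<Sum>v\<in>S. u v *\<^sub>R v) + t * sum u S" for u S
    using L by (simp add: linear_sum linear_scale distrib_left sum.distrib sum_distrib_left mult.commute)
  with L show ?thesis using that[of L t] by simp
qed

lemma affine_fun_sum:
  assumes "affine_fun f" "sum u S = 1"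
  shows "f (\<Sum>v\<in>S. u v *\<^sub>R v) = (\<Sum>v\<in>S. u v * f v)"
proof -
  obtain L t where "linear L" "\<And>x. f x = L x + t"
    "\<And>u S. (\<Sum>v\<in>S. u v * f v) = L (\<Sum>v\<in>S. u v *\<^sub>R v) + t * sum u S"
    using affine_fun_weighted[OF assms(1)] by blast
  then show ?thesis using assms(2) by simp
qed

lemma affine_fun_segment:
  assumes "affine_fun f"
  shows "f ((1 - u) *\<^sub>R a + u *\<^sub>R b) = (1 - u) * f a + u * f b"
proof -
  from assms obtain L t where "linear L" "f = (\<lambda>x. L x + t)" unfolding affine_fun_def by blast
  then show ?thesis by (simp add: linear_add linear_scale) (simp add: algebra_simps)
qed

lemma affine_fun_const: "affine_fun (\<lambda>x. t)"
  unfolding affine_fun_def by (intro exI[of _ "\<lambda>x. 0"] exI[of _ t]) (simp add: linear_iff)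

lemma affine_fun_linear: "linear L \<Longrightarrow> affine_fun L"
  unfolding affine_fun_def by (intro exI[of _ L] exI[of _ 0]) simp

lemma affine_fun_diff:
  assumes "affine_fun f" "affine_fun h"
  shows "affine_fun (\<lambda>x. f x - t * h x)"
proof -
  from assms obtain L a M b where "linear L" "f = (\<lambda>x. L x + a)" "linear M" "h = (\<lambda>x. M x + b)"
    unfolding affine_fun_def by blast
  then show ?thesis unfolding affine_fun_def
    by (intro exI[of _ "\<lambda>x. L x - t * M x"] exI[of _ "a - t * b"])
      (auto simp: linear_iff algebra_simps)
qed

lemma affine_fun_hull_zero:
  assumes f: "affine_fun f" and zero: "\<And>v. v \<in> S \<Longrightarrow> f v = 0" and x: "x \<in> affine hull S"
  shows "f x = 0"
proof -
  obtain F u where F: "finite F" "F \<subseteq> S" "sum u F = 1" "x = (\<Sum>v\<in>F. u v *\<^sub>R v)"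
    using x unfolding affine_hull_explicit by blast
  then show ?thesis using affine_fun_sum[OF f F(3)] zero by (simp add: subset_iff)
qed

lemma affine_fun_extend:
  assumes "\<not> affine_dependent B"
  shows "\<exists>f. affine_fun f \<and> (\<forall>b\<in>B. f b = c b)"
proof (cases "B = {}")
  case True
  then show ?thesis using affine_fun_const[of 0] by blast
next
  case False
  then obtain a where a: "a \<in> B" by blast
  have ind: "independent ((\<lambda>x. - a + x) ` (B - {a}))"
    using assms affine_dependent_iff_dependent2[OF a] by blast
  obtain L :: "'a \<Rightarrow> real" where L: "linear L"
    "\<And>x. x \<in> (\<lambda>x. - a + x) ` (B - {a}) \<Longrightarrow> L x = c (a + x) - c a"
    using linear_independent_extend[OF ind, of "\<lambda>x. c (a + x) - c a"] by blast
  let ?f = "\<lambda>x. L x + (c a - L a)"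
  have "?f b = c b" if "b \<in> B" for b
  proof (cases "b = a")
    case False
    then have "L (- a + b) = c b - c a" using L(2)[of "- a + b"] that by auto
    then show ?thesis using L(1) by (simp add: linear_diff)
  qed simp
  moreover have "affine_fun ?f" unfolding affine_fun_def using L(1) by blast
  ultimately show ?thesis by blast
qed

lemma affine_independent_insert:
  assumes B: "\<not> affine_dependent B" and a: "a \<notin> affine hull B"
  shows "\<not> affine_dependent (insert a B)"
proof
  assume "affine_dependent (insert a B)"
  then obtain S U where S: "finite S" "S \<subseteq> insert a B" "sum U S = 0" "\<exists>v\<in>S. U v \<noteq> 0"
      "(\<Sum>v\<in>S. U v *\<^sub>R v) = 0"
    unfolding affine_dependent_explicit by blast
  have aB: "a \<notin> B" using a by (meson hull_inc)
  show False
  proof (cases "a \<in> S \<and> U a \<noteq> 0")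
    case True
    let ?T = "S - {a}"
    have s: "sum U ?T = - U a" "(\<Sum>v\<in>?T. U v *\<^sub>R v) = - U a *\<^sub>R a"
      using S True by (simp_all add: sum_diff1)
    have "(\<Sum>v\<in>?T. - U v / U a) = 1"
      using s(1) True by (simp add: sum_negf flip: sum_divide_distrib)
    moreover have "(\<Sum>v\<in>?T. (- U v / U a) *\<^sub>R v) = (- 1 / U a) *\<^sub>R (\<Sum>v\<in>?T. U v *\<^sub>R v)"
      by (simp add: scaleR_right.sum)
    then have "(\<Sum>v\<in>?T. (- U v / U a) *\<^sub>R v) = a" using s(2) True by simp
    moreover from calculation have "?T \<noteq> {}" by (metis sum.empty zero_neq_one)
    ultimately have "a \<in> affine hull B"
      unfolding affine_hull_explicit using S(1,2)
      by (intro CollectI exI[of _ ?T] exI[of _ "\<lambda>v. - U v / U a"]) auto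
    then show False using a by blast
  next
    case False
    let ?T = "S - {a}"
    have "sum U ?T = 0" "(\<Sum>v\<in>?T. U v *\<^sub>R v) = 0"
      using S False by (auto simp: sum_diff1)
    moreover have "\<exists>v\<in>?T. U v \<noteq> 0" using S(4) False by auto
    moreover have "finite ?T" "?T \<subseteq> B" using S by auto
    ultimately have "affine_dependent B" unfolding affine_dependent_explicit by blast
    then show False using B by blast
  qed
qed

text \<open>The linear exchange bound after homogenization: appending the coordinate 1 turns affine
  independence and affine hulls into linear ones.\<close>

lemma affine_independent_card_le:
  fixes S T :: "'a::real_vector set"
  assumes S: "\<not> affine_dependent S" and T: "finite T" and sub: "S \<subseteq> affine hull T"
  shows "finite S \<and> card S \<le> card T"
proof -
  define \<iota> where "\<iota> = (\<lambda>x::'a. (x, 1::real))"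
  have inj: "inj_on \<iota> A" for A by (auto simp: \<iota>_def inj_on_def)
  have sum: "(\<Sum>v\<in>A. u v *\<^sub>R \<iota> v) = (\<Sum>v\<in>A. u v *\<^sub>R v, sum u A)" for u A
    by (induction A rule: infinite_finite_induct) (simp_all add: \<iota>_def zero_prod_def)
  have "independent (\<iota> ` S)"
  proof
    assume "dependent (\<iota> ` S)"
    then obtain W u where W: "finite W" "W \<subseteq> \<iota> ` S" "(\<Sum>v\<in>W. u v *\<^sub>R v) = 0" "\<exists>v\<in>W. u v \<noteq> 0"
      unfolding dependent_explicit by blast
    then obtain A where A: "A \<subseteq> S" "finite A" "W = \<iota> ` A" using finite_subset_image[OF W(1,2)] by blast
    have "(\<Sum>v\<in>A. u (\<iota> v) *\<^sub>R \<iota> v) = 0"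
      using W(3) unfolding A(3) by (simp add: sum.reindex[OF inj])
    then have "(\<Sum>v\<in>A. u (\<iota> v) *\<^sub>R v) = 0" "(\<Sum>v\<in>A. u (\<iota> v)) = 0"
      unfolding sum by (simp_all add: zero_prod_def)
    moreover have "\<exists>v\<in>A. u (\<iota> v) \<noteq> 0" using W(4) A by blast
    ultimately have "affine_dependent S"
      unfolding affine_dependent_explicit using A(1,2)
      by (intro exI[of _ A] exI[of _ "\<lambda>v. u (\<iota> v)"]) auto
    then show False using S by blast
  qed
  moreover have "\<iota> ` S \<subseteq> span (\<iota> ` T)"
  proof
    fix y assume "y \<in> \<iota> ` S"
    then obtain x where x: "x \<in> S" "y = \<iota> x" by blast
    then obtain u where u: "sum u T = 1" "(\<Sum>v\<in>T. u v *\<^sub>R v) = x"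
      using sub unfolding affine_hull_finite[OF T] by blast
    have "y = (\<Sum>v\<in>T. u v *\<^sub>R \<iota> v)" unfolding sum u by (simp add: x \<iota>_def)
    then show "y \<in> span (\<iota> ` T)" by (simp add: span_sum span_scale span_base)
  qed
  ultimately have "finite (\<iota> ` S) \<and> card (\<iota> ` S) \<le> card (\<iota> ` T)"
    using independent_span_bound[of "\<iota> ` T"] T by blast
  then show ?thesis
    using card_image[OF inj] card_image_le[OF T, of \<iota>] finite_imageD[OF _ inj] by metis
qed

text \<open>Unless \<open>W\<close> is a singleton, the point lies between \<open>w\<close> and the
  normalized combination \<open>y\<close> of the other points, so the face contains both ends; if
  \<open>y = w\<close>, the point is \<open>w\<close> itself.\<close>

lemma face_contains_support:
  assumes F: "F face_of P" and P: "convex P" and W: "finite W" "W \<subseteq> P"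
    and u: "\<And>w. w \<in> W \<Longrightarrow> 0 < u w" "sum u W = 1" and x: "(\<Sum>w\<in>W. u w *\<^sub>R w) \<in> F"
  shows "W \<subseteq> F"
proof
  fix w assume w: "w \<in> W"
  let ?x = "\<Sum>w\<in>W. u w *\<^sub>R w"
  show "w \<in> F"
  proof (cases "W = {w}")
    case True
    then show ?thesis using u x by simp
  next
    case False
    have "0 < sum u (W - {w})" using False w W u by (intro sum_pos) auto
    then have lt: "u w < 1" using u(2) w W by (simp add: sum_diff1)
    define y where "y = (\<Sum>v\<in>W - {w}. (u v / (1 - u w)) *\<^sub>R v)"
    have y: "y \<in> P" unfolding y_def
    proof (rule convex_sum[OF _ P])
      show "(\<Sum>i\<in>W - {w}. u i / (1 - u w)) = 1"
        using u(2) w W lt by (simp add: sum_diff1 flip: sum_divide_distrib)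
    qed (use W u(1) lt in \<open>auto intro: less_imp_le divide_nonneg_pos\<close>)
    have "(1 - u w) *\<^sub>R y = (\<Sum>v\<in>W - {w}. u v *\<^sub>R v)"
      unfolding y_def using lt by (simp add: scaleR_right.sum)
    then have eq: "?x = (1 - u w) *\<^sub>R y + u w *\<^sub>R w" using w W by (simp add: sum_diff1)
    show ?thesis
    proof (cases "y = w")
      case True
      then show ?thesis using x unfolding eq by (simp flip: scaleR_add_left)
    next
      case False
      then have "?x \<in> open_segment y w" unfolding in_segment(2) using eq lt u(1)[OF w] by blast
      then show ?thesis using face_ofD[OF F _ y _ x] w W by blast
    qed
  qed
qed

lemma face_eq_hull_vertices:
  assumes V: "finite V" and F: "F face_of (convex hull V)"
  shows "F = convex hull (F \<inter> V)"
proof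
  have "convex F" using F by (rule face_of_imp_convex)
  then show "convex hull (F \<inter> V) \<subseteq> F" by (simp add: hull_minimal)
  show "F \<subseteq> convex hull (F \<inter> V)"
  proof
    fix x assume x: "x \<in> F"
    then have "x \<in> convex hull V" using F face_of_imp_subset by blast
    then obtain u where u: "\<And>v. v \<in> V \<Longrightarrow> 0 \<le> u v" "sum u V = 1" "(\<Sum>v\<in>V. u v *\<^sub>R v) = x"
      unfolding convex_hull_finite[OF V] by blast
    define W where "W = {v\<in>V. 0 < u v}"
    have z: "u v = 0" if "v \<in> V - W" for v using that u(1)[of v] by (auto simp: W_def)
    have W: "finite W" "W \<subseteq> V" using V by (auto simp: W_def)
    have "sum u W = sum u V" "(\<Sum>v\<in>W. u v *\<^sub>R v) = (\<Sum>v\<in>V. u v *\<^sub>R v)"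
      by (rule sum.mono_neutral_left[OF V W(2)]; simp add: z)+
    then have s: "sum u W = 1" "(\<Sum>v\<in>W. u v *\<^sub>R v) = x" using u by simp_all
    have "W \<subseteq> convex hull V" by (rule order_trans[OF W(2) hull_subset])
    then have "W \<subseteq> F"
      by (rule face_contains_support[OF F convex_convex_hull W(1), of u])
        (use s x in \<open>simp_all add: W_def\<close>)
    have "x \<in> convex hull W"
      unfolding convex_hull_finite[OF W(1)] using s by (auto simp: W_def intro!: exI[of _ u] less_imp_le)
    moreover have "convex hull W \<subseteq> convex hull (F \<inter> V)"
      using \<open>W \<subseteq> F\<close> W(2) by (intro hull_mono) simp
    ultimately show "x \<in> convex hull (F \<inter> V)" by (rule subsetD[rotated])
  qed
qed

text \<open>The line from \<open>x\<close> through the barycenter \<open>y\<close> of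
  \<open>S\<close> stays in \<open>convex hull S\<close> for a short way beyond \<open>y\<close>, up
  to \<open>z\<close>. Then \<open>y\<close> is in the open segment from \<open>z\<close> to
  \<open>x\<close>, and the face property captures \<open>x\<close>.\<close>

lemma face_eq_affine_Int:
  assumes P: "convex P" and F: "(convex hull S) face_of P" and S: "finite S" "S \<noteq> {}"
    and x: "x \<in> P" "x \<in> affine hull S"
  shows "x \<in> convex hull S"
proof -
  obtain w where w: "sum w S = 1" "(\<Sum>s\<in>S. w s *\<^sub>R s) = x"
    using x(2) unfolding affine_hull_finite[OF S(1)] by blast
  define m where "m = real (card S)"
  have m: "0 < m" using S by (simp add: m_def card_gt_0_iff)
  define M where "M = (\<Sum>s\<in>S. \<bar>w s\<bar>)"
  have M: "0 \<le> M" by (simp add: M_def sum_nonneg)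
  \<comment> \<open>Small enough that the weights
    \<open>(1 + \<epsilon>) / m - \<epsilon> * w s\<close> of \<open>z\<close> stay
    nonnegative.\<close>
  define \<epsilon> where "\<epsilon> = 1 / (m * (1 + M))"
  have \<epsilon>: "0 < \<epsilon>" using m M by (simp add: \<epsilon>_def)
  have b: "\<epsilon> * w s \<le> 1 / m" if "s \<in> S" for s
  proof -
    have "\<bar>w s\<bar> \<le> M" unfolding M_def using S(1) that by (intro member_le_sum) auto
    then have "w s \<le> 1 + M" by linarith
    then have "\<epsilon> * w s \<le> \<epsilon> * (1 + M)" using \<epsilon> by simp
    also have "\<epsilon> * (1 + M) = 1 / m" using M by (simp add: \<epsilon>_def)
    finally show ?thesis .
  qed
  define y where "y = (\<Sum>s\<in>S. (1 / m) *\<^sub>R s)"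
  define z where "z = (\<Sum>s\<in>S. ((1 + \<epsilon>) / m - \<epsilon> * w s) *\<^sub>R s)"
  have y: "y \<in> convex hull S" unfolding y_def
    by (rule convex_sum[OF S(1) convex_convex_hull]) (use m in \<open>auto simp: m_def hull_inc\<close>)
  have z: "z \<in> convex hull S" unfolding z_def
  proof (rule convex_sum[OF S(1) convex_convex_hull])
    have "(\<Sum>i\<in>S. (1 + \<epsilon>) / m - \<epsilon> * w i) = m * ((1 + \<epsilon>) / m) - \<epsilon> * sum w S"
      by (simp add: sum_subtractf m_def sum_distrib_left)
    then show "(\<Sum>i\<in>S. (1 + \<epsilon>) / m - \<epsilon> * w i) = 1" using w m by simp
    show "0 \<le> (1 + \<epsilon>) / m - \<epsilon> * w i" if "i \<in> S" for i
      using b[OF that] \<epsilon> m by (simp add: add_divide_distrib add_increasing2)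
  qed (simp add: hull_inc)
  have "z = (1 + \<epsilon>) *\<^sub>R y - \<epsilon> *\<^sub>R x"
    unfolding z_def y_def w(2)[symmetric]
    by (simp add: scaleR_diff_left sum_subtractf scaleR_right.sum)
  then have "(1 + \<epsilon>) *\<^sub>R y = z + \<epsilon> *\<^sub>R x" by simp
  then have "(1 / (1 + \<epsilon>)) *\<^sub>R ((1 + \<epsilon>) *\<^sub>R y) = (1 / (1 + \<epsilon>)) *\<^sub>R (z + \<epsilon> *\<^sub>R x)" by simp
  then have yz: "y = (1 / (1 + \<epsilon>)) *\<^sub>R z + (\<epsilon> / (1 + \<epsilon>)) *\<^sub>R x"
    using \<epsilon> by (simp add: scaleR_add_right)
  show ?thesis
  proof (cases "z = x")
    case True
    then show ?thesis using z by simp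
  next
    case False
    have "1 - \<epsilon> / (1 + \<epsilon>) = 1 / (1 + \<epsilon>)" using \<epsilon> by (simp add: field_simps)
    then have "y \<in> open_segment z x" unfolding in_segment(2)
      using False yz \<epsilon> by (intro conjI exI[of _ "\<epsilon> / (1 + \<epsilon>)"]) auto
    then show ?thesis
      using face_ofD[OF F _ _ x(1) y] z face_of_imp_subset[OF F] by blast
  qed
qed

text \<open>In a generating set of least cardinality no point is in the hull of the others, so each
  is extreme.\<close>

lemma polytope_eq_hull_vertices:
  assumes "polytope P"
  shows "finite (vertices P)" "P = convex hull (vertices P)"
proof -
  obtain S where S: "finite S" "P = convex hull S" using assms unfolding polytope_def by blast
  define n where "n = (LEAST n. \<exists>T. finite T \<and> P = convex hull T \<and> card T = n)"
  obtain T where T: "finite T" "P = convex hull T" "card T = n"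
    using LeastI[of "\<lambda>n. \<exists>T. finite T \<and> P = convex hull T \<and> card T = n" "card S"] S
    unfolding n_def by blast
  have min: "n \<le> card U" if "finite U" "P = convex hull U" for U
    unfolding n_def using that by (intro Least_le) blast
  have "v extreme_point_of P" if v: "v \<in> T" for v
  proof -
    have "v \<notin> convex hull (T - {v})"
    proof
      assume "v \<in> convex hull (T - {v})"
      then have "P = convex hull (T - {v})"
        using hull_redundant[of v convex "T - {v}"] v T(2) by (simp add: insert_absorb)
      then have "n \<le> card (T - {v})" using min T(1) by simp
      then show False using card_Diff1_less[OF T(1) v] T(3) by simp
    qed
    then show ?thesis
      using extreme_point_of_convex_hull_insert[of "T - {v}" v] T v by (simp add: insert_absorb)
  qed
  then have "vertices P = T"
    using extreme_point_of_convex_hull T(2) unfolding vertices_def by blast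
  then show "finite (vertices P)" "P = convex hull (vertices P)" using T by simp_all
qed

lemma vertices_face:
  assumes "F face_of P"
  shows "vertices F = vertices P \<inter> F"
  using extreme_point_of_face[OF assms] by (auto simp: vertices_def)

lemma affine_fun_face:
  assumes f: "affine_fun f" and P: "convex P" and nn: "\<And>x. x \<in> P \<Longrightarrow> 0 \<le> f x"
  shows "{x\<in>P. f x = 0} face_of P"
  unfolding face_of_def
proof (intro conjI ballI impI)
  show "convex {x\<in>P. f x = 0}"
    unfolding convex_alt
  proof (intro ballI allI impI, elim conjE)
    fix x y u assume "x \<in> {x\<in>P. f x = 0}" "y \<in> {x\<in>P. f x = 0}" "0 \<le> u" "u \<le> (1::real)"
    then show "(1 - u) *\<^sub>R x + u *\<^sub>R y \<in> {x\<in>P. f x = 0}"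
      using P unfolding convex_alt by (simp add: affine_fun_segment[OF f])
  qed
  fix a b x assume ab: "a \<in> P" "b \<in> P" and x: "x \<in> {x\<in>P. f x = 0}" "x \<in> open_segment a b"
  then obtain u where u: "0 < u" "u < 1" "x = (1 - u) *\<^sub>R a + u *\<^sub>R b" unfolding in_segment(2) by blast
  have "(1 - u) * f a + u * f b = 0" using x(1) u(3) affine_fun_segment[OF f] by auto
  moreover have "0 \<le> (1 - u) * f a" "0 \<le> u * f b" using u nn ab by auto
  ultimately have "(1 - u) * f a = 0" "u * f b = 0" by linarith+
  then show "a \<in> {x\<in>P. f x = 0}" "b \<in> {x\<in>P. f x = 0}" using u ab by auto
qed auto

lemma affine_fun_hull_nonneg:
  assumes f: "affine_fun f" and V: "finite V" and nn: "\<And>v. v \<in> V \<Longrightarrow> 0 \<le> f v"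
    and x: "x \<in> convex hull V"
  shows "0 \<le> f x"
proof -
  obtain u where u: "\<And>v. v \<in> V \<Longrightarrow> 0 \<le> u v" "sum u V = 1" "(\<Sum>v\<in>V. u v *\<^sub>R v) = x"
    using x unfolding convex_hull_finite[OF V] by blast
  then show ?thesis using affine_fun_sum[OF f u(2)] nn by (auto intro!: sum_nonneg)
qed

subsection \<open>Gale diagrams\<close>

lemma extend_by_zero:
  fixes g :: "'a \<Rightarrow> complex"
  assumes V: "finite V" and C: "C \<subseteq> V"
  shows "(\<Sum>v\<in>V. (if v \<in> C then c v else 0) *\<^sub>R g v) = (\<Sum>v\<in>C. c v *\<^sub>R g v)"
proof -
  have "(\<Sum>v\<in>V. (if v \<in> C then c v else 0) *\<^sub>R g v) = (\<Sum>v\<in>C. (if v \<in> C then c v else 0) *\<^sub>R g v)"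
    by (rule sum.mono_neutral_right[OF V C]) simp
  then show ?thesis by simp
qed

text \<open>\<open>orth\<close> and \<open>complete\<close> are the two inclusions of the duality
  between affine functionals on \<open>V\<close> and dependences of \<open>g\<close>;
  \<open>spanning\<close> says that the vectors span the plane. That all points of \<open>V\<close>
  are vertices is not assumed; it is derived from the half-plane condition where needed.\<close>

locale gale =
  fixes V :: "'a::real_vector set" and g :: "'a \<Rightarrow> complex" and d :: nat
  assumes finV: "finite V" and d1: "1 \<le> d"
    and dim: "\<exists>B. finite B \<and> \<not> affine_dependent B \<and> affine hull B = affine hull V \<and> card B = d + 1"
    and orth: "\<And>f. affine_fun f \<Longrightarrow> (\<Sum>v\<in>V. f v *\<^sub>R g v) = 0"
    and complete: "\<And>c. (\<Sum>v\<in>V. c v *\<^sub>R g v) = 0 \<Longrightarrow> \<exists>f. affine_fun f \<and> (\<forall>v\<in>V. f v = c v)"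
    and spanning: "\<And>z. z \<noteq> 0 \<Longrightarrow> \<exists>v\<in>V. z \<bullet> g v \<noteq> 0"
begin

abbreviation P :: "'a set" where "P \<equiv> convex hull V"

lemma V_P: "V \<subseteq> P"
  by (rule hull_subset)

lemma independent_card:
  assumes "\<not> affine_dependent S" "S \<subseteq> affine hull V"
  shows "finite S" "card S \<le> d + 1"
proof -
  obtain B where B: "finite B" "affine hull B = affine hull V" "card B = d + 1" using dim by blast
  then have "finite S \<and> card S \<le> card B"
    using affine_independent_card_le[OF assms(1) B(1)] assms(2) by simp
  then show "finite S" "card S \<le> d + 1" using B(3) by simp_all
qed

lemma independent_max:
  assumes S: "\<not> affine_dependent S" "S \<subseteq> affine hull V" and card: "card S = d + 1"
  shows "affine hull S = affine hull V"
proof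
  show "affine hull S \<subseteq> affine hull V" using S(2) by (simp add: hull_minimal)
  have "x \<in> affine hull S" if x: "x \<in> affine hull V" for x
  proof (rule ccontr)
    assume n: "x \<notin> affine hull S"
    then have "x \<notin> S" by (meson hull_inc)
    have "\<not> affine_dependent (insert x S)" using affine_independent_insert[OF S(1) n] .
    then have "card (insert x S) \<le> d + 1" using independent_card(2) S(2) x by blast
    then show False using card \<open>x \<notin> S\<close> independent_card(1)[OF S] by simp
  qed
  then show "affine hull V \<subseteq> affine hull S" by blast
qed

lemma basis_card:
  assumes "\<not> affine_dependent S" "affine hull S = affine hull V"
  shows "finite S" "card S = d + 1"
proof -
  have sub: "S \<subseteq> affine hull V" using assms(2) hull_subset[of S affine] by simp
  obtain B where B: "\<not> affine_dependent B" "affine hull B = affine hull V" "card B = d + 1"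
    using dim by blast
  show f: "finite S" using independent_card(1)[OF assms(1) sub] .
  have "B \<subseteq> affine hull S" using B(2) assms(2) hull_subset[of B affine] by simp
  then have "card B \<le> card S" using affine_independent_card_le[OF B(1) f] by blast
  then show "card S = d + 1" using B(3) independent_card(2)[OF assms(1) sub] by simp
qed

lemma exposed_face:
  assumes f: "affine_fun f" and nn: "\<And>v. v \<in> V \<Longrightarrow> 0 \<le> f v"
  defines "F \<equiv> convex hull {v\<in>V. f v = 0}"
  shows "F face_of P" "V \<inter> F = {v\<in>V. f v = 0}"
proof -
  let ?F = "{x\<in>P. f x = 0}"
  have face: "?F face_of P"
    using affine_fun_face[OF f convex_convex_hull] affine_fun_hull_nonneg[OF f finV nn] by blast
  have "?F \<inter> V = {v\<in>V. f v = 0}" using V_P by blast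
  then have "?F = F" using face_eq_hull_vertices[OF finV face] by (simp add: F_def)
  then show "F face_of P" using face by simp
  show "V \<inter> F = {v\<in>V. f v = 0}" using V_P \<open>?F = F\<close> by blast
qed

lemma circuit_functional:
  assumes C: "C \<subseteq> V" and c: "(\<Sum>v\<in>C. c v *\<^sub>R g v) = 0"
  shows "\<exists>f. affine_fun f \<and> (\<forall>v\<in>V. f v = (if v \<in> C then c v else 0))"
  by (rule complete) (simp only: extend_by_zero[OF finV C] c)

text \<open>The dependence on \<open>C\<close>, extended by zero, is the list of values of a
  functional that is nonnegative on \<open>V\<close> and zero exactly on \<open>V - C\<close>, so
  this set spans a face. A face of lower dimension would admit two nonproportional functionals,
  contradicting uniqueness of the dependence.\<close>

lemma circuit_facet:
  assumes "C \<in> circuits V g"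
  shows "convex hull (V - C) \<in> facets P" "V \<inter> convex hull (V - C) = V - C"
proof -
  have CV: "C \<subseteq> V" and pc: "pos_circuit g C" using assms by (auto simp: circuits_def)
  obtain c where c: "\<And>v. v \<in> C \<Longrightarrow> 0 < c v" "(\<Sum>v\<in>C. c v *\<^sub>R g v) = 0" and Cne: "C \<noteq> {}"
    and uniq: "\<And>c'. (\<Sum>v\<in>C. c' v *\<^sub>R g v) = 0 \<Longrightarrow> \<exists>t. \<forall>v\<in>C. c' v = t * c v"
    using pc unfolding pos_circuit_def by blast
  obtain f where f: "affine_fun f" "\<And>v. v \<in> V \<Longrightarrow> f v = (if v \<in> C then c v else 0)"
    using circuit_functional[OF CV c(2)] by blast
  have nn: "0 \<le> f v" if "v \<in> V" for v using f(2)[OF that] c(1)[of v] by (auto simp: less_imp_le)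
  have "f v = 0 \<longleftrightarrow> v \<notin> C" if "v \<in> V" for v using f(2)[OF that] c(1)[of v] by auto
  then have zero: "{v\<in>V. f v = 0} = V - C" by auto
  let ?S = "V - C"
  have face: "convex hull ?S face_of P" and VF: "V \<inter> convex hull ?S = ?S"
    using exposed_face[OF f(1) nn] unfolding zero by simp_all
  obtain B where B: "B \<subseteq> ?S" "\<not> affine_dependent B" "affine hull ?S = affine hull B"
    using affine_basis_exists[of ?S] by blast
  have BV: "B \<subseteq> affine hull V" using B(1) hull_subset[of V affine] by blast
  have fB: "finite B" using independent_card(1)[OF B(2) BV] .
  have upper: "card B \<le> d"
  proof -
    obtain v0 where v0: "v0 \<in> C" using Cne by blast
    then have "0 < f v0" using f(2)[of v0] c(1)[of v0] CV by auto
    moreover have "f x = 0" if "x \<in> affine hull B" for x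
      by (rule affine_fun_hull_zero[OF f(1) _ that]) (use B(1) f(2) in auto)
    ultimately have n: "v0 \<notin> affine hull B" by force
    then have "v0 \<notin> B" by (meson hull_inc)
    have "insert v0 B \<subseteq> affine hull V" using BV v0 CV hull_subset[of V affine] by blast
    then have "card (insert v0 B) \<le> d + 1"
      using independent_card(2) affine_independent_insert[OF B(2) n] by blast
    then show ?thesis using fB \<open>v0 \<notin> B\<close> by simp
  qed
  have lower: "d \<le> card B"
  proof (rule ccontr)
    assume less: "\<not> d \<le> card B"
    have "B \<subseteq> V" using B(1) by blast
    then obtain T where T: "\<not> affine_dependent T" "B \<subseteq> T" "T \<subseteq> V" "affine hull T = affine hull V"
      using extend_to_affine_basis[OF B(2)] by blast
    have "finite T" "card T = d + 1" using basis_card[OF T(1,4)] .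
    then have "2 \<le> card (T - B)" using less T(2) fB by (simp add: card_Diff_subset)
    then obtain A where "A \<subseteq> T - B" "card A = 2" by (metis obtain_subset_with_card_n)
    then obtain e1 e2 where e: "e1 \<in> T - B" "e2 \<in> T - B" "e1 \<noteq> e2"
      unfolding card_2_iff by blast
    have supp: "\<exists>t. \<forall>v\<in>C. h v = t * c v" "\<And>v. v \<in> V - C \<Longrightarrow> h v = 0"
      if h: "affine_fun h" "\<And>b. b \<in> B \<Longrightarrow> h b = 0" for h
    proof -
      show z: "h v = 0" if "v \<in> V - C" for v
        by (rule affine_fun_hull_zero[OF h]) (use that B(3) hull_subset[of ?S affine] in auto)
      have "(\<Sum>v\<in>C. h v *\<^sub>R g v) = (\<Sum>v\<in>V. h v *\<^sub>R g v)"
        by (rule sum.mono_neutral_left[OF finV CV]) (simp add: z)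
      then show "\<exists>t. \<forall>v\<in>C. h v = t * c v" using uniq orth[OF h(1)] by simp
    qed
    \<comment> \<open>\<open>h\<close> and \<open>h'\<close> are the coordinate functions of
      \<open>e1\<close> and \<open>e2\<close> in the basis \<open>T\<close>. Both vanish off
      \<open>C\<close>, so both points are in \<open>C\<close>; being a multiple of the positive
      \<open>c\<close>, \<open>h\<close> cannot be 1 at \<open>e1\<close> and 0 at
      \<open>e2\<close>.\<close>
    obtain h where h: "affine_fun h" "\<And>v. v \<in> T \<Longrightarrow> h v = (if v = e1 then 1 else 0)"
      using affine_fun_extend[OF T(1), of "\<lambda>v. if v = e1 then 1 else 0"] by blast
    obtain h' where h': "affine_fun h'" "\<And>v. v \<in> T \<Longrightarrow> h' v = (if v = e2 then 1 else 0)"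
      using affine_fun_extend[OF T(1), of "\<lambda>v. if v = e2 then 1 else 0"] by blast
    have hB: "h b = 0" "h' b = 0" if "b \<in> B" for b using h(2)[of b] h'(2)[of b] that e T(2) by auto
    obtain t where t: "\<And>v. v \<in> C \<Longrightarrow> h v = t * c v" using supp(1)[OF h(1) hB(1)] by blast
    have "e1 \<in> C" using supp(2)[OF h(1) hB(1), of e1] h(2)[of e1] e(1) T(3) by auto
    moreover have "e2 \<in> C" using supp(2)[OF h'(1) hB(2), of e2] h'(2)[of e2] e(2) T(3) by auto
    ultimately show False
      using t[of e1] t[of e2] h(2)[of e1] h(2)[of e2] e c(1)[of e2] by auto
  qed
  have "has_aff_dim P (int d)"
    unfolding has_aff_dim_def affine_hull_convex_hull using dim by (metis of_nat_add of_nat_1)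
  moreover have "has_aff_dim (convex hull ?S) (int d - 1)"
    unfolding has_aff_dim_def affine_hull_convex_hull
    using fB B upper lower by (intro exI[of _ B]) simp
  moreover have "convex hull ?S \<noteq> {}"
  proof -
    have "B \<noteq> {}" using lower d1 by auto
    then show ?thesis using B(1) by auto
  qed
  ultimately show "convex hull ?S \<in> facets P" using face unfolding facets_def by blast
  show "V \<inter> convex hull ?S = ?S" by (rule VF)
qed

text \<open>A basis of the facet and one vertex \<open>v0\<close> outside form an affine basis of
  the whole hull. The functional that is 0 on the former and 1 at \<open>v0\<close> supports the
  facet, and every functional vanishing on the facet is a multiple of it.\<close>

lemma facet_circuit:
  assumes "F \<in> facets P"
  shows "V - F \<in> circuits V g"
proof -
  obtain d' where F: "F face_of P" "F \<noteq> {}" and d': "has_aff_dim P d'" "has_aff_dim F (d' - 1)"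
    using assms unfolding facets_def by blast
  let ?S = "F \<inter> V"
  have FS: "F = convex hull ?S" using face_eq_hull_vertices[OF finV F(1)] .
  obtain B' where B': "\<not> affine_dependent B'" "affine hull B' = affine hull V" "int (card B') = d' + 1"
    using d'(1) unfolding has_aff_dim_def affine_hull_convex_hull by blast
  then have "d' = int d" using basis_card(2)[OF B'(1,2)] by simp
  then obtain B where B: "finite B" "\<not> affine_dependent B" "affine hull B = affine hull F" "card B = d"
    using d'(2) unfolding has_aff_dim_def by auto
  have affF: "affine hull F = affine hull ?S" using FS affine_hull_convex_hull[of ?S] by simp
  have finS: "finite ?S" using finV by simp
  have Sne: "?S \<noteq> {}" using FS F(2) by auto
  have BV: "B \<subseteq> affine hull V"
  proof -
    have "B \<subseteq> affine hull ?S" using B(3) affF hull_subset[of B affine] by simp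
    also have "\<dots> \<subseteq> affine hull V" by (rule hull_mono) simp
    finally show ?thesis .
  qed
  have "\<not> V \<subseteq> affine hull B"
  proof
    assume V: "V \<subseteq> affine hull B"
    then have "affine hull V \<subseteq> affine hull B" by (simp add: hull_minimal)
    moreover have "affine hull B \<subseteq> affine hull V" using BV by (simp add: hull_minimal)
    ultimately have "affine hull B = affine hull V" by blast
    then show False using basis_card(2)[OF B(2)] B(4) by simp
  qed
  then obtain v0 where v0: "v0 \<in> V" "v0 \<notin> affine hull B" by blast
  let ?T = "insert v0 B"
  have T: "\<not> affine_dependent ?T" using affine_independent_insert[OF B(2) v0(2)] .
  have v0B: "v0 \<notin> B" using v0(2) by (meson hull_inc)
  have Tsub: "?T \<subseteq> affine hull V" using BV v0(1) hull_subset[of V affine] by blast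
  have affT: "affine hull ?T = affine hull V"
    using independent_max[OF T Tsub] B(1,4) v0B by simp
  obtain f where f: "affine_fun f" "\<And>b. b \<in> ?T \<Longrightarrow> f b = (if b = v0 then 1 else 0)"
    using affine_fun_extend[OF T, of "\<lambda>b. if b = v0 then 1 else 0"] by blast
  have fB: "f b = 0" if "b \<in> B" for b using f(2)[of b] that v0B by auto
  have f0: "f v0 = 1" using f(2)[of v0] by simp
  have fF: "f x = 0" if "x \<in> F" for x
    by (rule affine_fun_hull_zero[OF f(1) fB]) (use that B(3) hull_subset[of F affine] in auto)
  have mem: "x \<in> F" if x: "x \<in> P" "f x = 0" for x
  proof -
    have "x \<in> affine hull ?T" using x(1) affT convex_hull_subset_affine_hull[of V] by blast
    moreover have "finite ?T" using B(1) by simp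
    ultimately obtain u where u: "sum u ?T = 1" "(\<Sum>v\<in>?T. u v *\<^sub>R v) = x"
      using affine_hull_finite[of ?T] by blast
    have "f x = (\<Sum>v\<in>?T. u v * f v)" using affine_fun_sum[OF f(1) u(1)] u(2) by simp
    also have "\<dots> = u v0" using B(1) v0B fB f0 by simp
    finally have "u v0 = 0" using x(2) by simp
    then have "sum u B = 1" "(\<Sum>v\<in>B. u v *\<^sub>R v) = x" using u B(1) v0B by simp_all
    then have "x \<in> affine hull ?S" unfolding affF[symmetric] B(3)[symmetric] affine_hull_finite[OF B(1)] by blast
    then have "x \<in> convex hull ?S"
      using face_eq_affine_Int[OF convex_convex_hull _ finS Sne x(1)] F(1) FS by simp
    then show ?thesis using FS by simp
  qed
  have nn: "0 \<le> f v" if v: "v \<in> V" for v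
  proof (rule ccontr)
    assume "\<not> 0 \<le> f v"
    then have neg: "f v < 0" by simp
    \<comment> \<open>The parameter at which \<open>f\<close> vanishes on the segment from
      \<open>v\<close> to \<open>v0\<close>; the crossing point is in \<open>F\<close>, which forces
      \<open>v\<close> into \<open>F\<close>.\<close>
    define u where "u = f v / (f v - 1)"
    have u: "0 < u" "u < 1" using neg by (simp_all add: u_def divide_neg_neg field_simps)
    let ?x = "(1 - u) *\<^sub>R v + u *\<^sub>R v0"
    have "f ?x = (1 - u) * f v + u * f v0" by (rule affine_fun_segment[OF f(1)])
    also have "\<dots> = 0" using neg f0 by (simp add: u_def field_simps)
    finally have fx: "f ?x = 0" .
    have "v \<in> P" "v0 \<in> P" using v v0(1) V_P by auto
    then have "?x \<in> P" using convex_convex_hull[of V] u unfolding convex_alt by simp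
    then have "?x \<in> F" using mem fx by blast
    moreover have "?x \<in> open_segment v v0" unfolding in_segment(2) using u neg f0 by auto
    ultimately have "v \<in> F" using face_ofD[OF F(1)] \<open>v \<in> P\<close> \<open>v0 \<in> P\<close> by blast
    then show False using fF neg by fastforce
  qed
  let ?C = "V - F"
  have pos: "0 < f v" if "v \<in> ?C" for v
    using that nn[of v] mem[of v] V_P by (metis DiffD1 DiffD2 order_le_less subsetD)
  have sumC: "(\<Sum>v\<in>?C. f v *\<^sub>R g v) = 0"
  proof -
    have "(\<Sum>v\<in>?C. f v *\<^sub>R g v) = (\<Sum>v\<in>V. f v *\<^sub>R g v)"
      by (rule sum.mono_neutral_left[OF finV]) (use fF in auto)
    then show ?thesis using orth[OF f(1)] by simp
  qed
  have v0C: "v0 \<in> ?C" using v0(1) fF[of v0] f0 by auto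
  have uniq: "\<exists>t. \<forall>v\<in>?C. c' v = t * f v" if c': "(\<Sum>v\<in>?C. c' v *\<^sub>R g v) = 0" for c'
  proof -
    obtain h where h: "affine_fun h" "\<And>v. v \<in> V \<Longrightarrow> h v = (if v \<in> ?C then c' v else 0)"
      using circuit_functional[OF Diff_subset c'] by blast
    \<comment> \<open>Zero on the affine basis \<open>?T\<close>, hence on \<open>V\<close>; this
      identifies \<open>c'\<close> as \<open>h v0\<close> times \<open>f\<close>.\<close>
    let ?k = "\<lambda>x. h x - h v0 * f x"
    have k: "affine_fun ?k" using affine_fun_diff[OF h(1) f(1)] .
    have hB: "h b = 0" if "b \<in> B" for b
    proof (rule affine_fun_hull_zero[OF h(1)])
      show "b \<in> affine hull ?S" using that B(3) affF hull_subset[of B affine] by auto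
    qed (use h(2) in auto)
    have kT: "?k b = 0" if "b \<in> ?T" for b
      using that hB fB f0 by auto
    have "?k v = 0" if "v \<in> V" for v
    proof (rule affine_fun_hull_zero[OF k])
      show "v \<in> affine hull ?T" using that affT hull_subset[of V affine] by auto
    qed (rule kT)
    then have "\<forall>v\<in>?C. c' v = h v0 * f v" using h(2) by fastforce
    then show ?thesis by blast
  qed
  have "pos_circuit g ?C"
    unfolding pos_circuit_def using pos sumC v0C uniq by blast
  then show ?thesis by (simp add: circuits_def)
qed

lemma card_facets: "card (facets P) = card (circuits V g)"
proof -
  have "bij_betw (\<lambda>F. V - F) (facets P) (circuits V g)"
  proof (rule bij_betw_byWitness[where f' = "\<lambda>C. convex hull (V - C)"])
    show "\<forall>F\<in>facets P. convex hull (V - (V - F)) = F"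
    proof
      fix F assume "F \<in> facets P"
      then have "F face_of P" by (simp add: facets_def)
      then show "convex hull (V - (V - F)) = F"
        using face_eq_hull_vertices[OF finV] by (simp add: Diff_Diff_Int Int_commute)
    qed
    show "\<forall>C\<in>circuits V g. V - convex hull (V - C) = C"
    proof
      fix C assume C: "C \<in> circuits V g"
      then have "C \<subseteq> V" by (simp add: circuits_def)
      then show "V - convex hull (V - C) = C" using circuit_facet(2)[OF C] by blast
    qed
  qed (use facet_circuit circuit_facet in auto)
  then show ?thesis by (rule bij_betw_same_card)
qed

text \<open>Without the at most \<open>k\<close> vectors of \<open>S\<close> every open half-plane
  still contains a vector, so each remaining vertex is in a circuit avoiding \<open>S\<close>. The
  sum of the corresponding functionals vanishes exactly on \<open>S\<close>.\<close>

lemma half_planes_exposed: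
  assumes H: "half_planes (k + 1) V g" and S: "S \<subseteq> V" "card S \<le> k"
  shows "\<exists>f. affine_fun f \<and> (\<forall>v\<in>V. 0 \<le> f v) \<and> {v\<in>V. f v = 0} = S"
proof -
  let ?W = "V - S"
  have finW: "finite ?W" using finV by simp
  have HW: "half_planes 1 ?W g"
    unfolding half_planes_def
  proof (intro allI impI)
    fix z :: complex assume "z \<noteq> 0"
    then have "k + 1 \<le> card {v\<in>V. 0 < z \<bullet> g v}" using H by (simp add: half_planes_def)
    also have "\<dots> \<le> card ({v\<in>?W. 0 < z \<bullet> g v} \<union> S)"
      using finV S(1) finite_subset[OF S(1)] by (intro card_mono) auto
    also have "\<dots> \<le> card {v\<in>?W. 0 < z \<bullet> g v} + card S" by (rule card_Un_le)
    finally show "1 \<le> card {v\<in>?W. 0 < z \<bullet> g v}" using S(2) by simp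
  qed
  have "\<forall>p\<in>?W. \<exists>f. affine_fun f \<and> (\<forall>v\<in>V. 0 \<le> f v) \<and> (\<forall>v\<in>S. f v = 0) \<and> 0 < f p"
  proof
    fix p assume p: "p \<in> ?W"
    obtain C where C: "C \<in> circuits ?W g" "p \<in> C"
      using half_planes_circuit[OF HW _ finW p] by auto
    obtain c where c: "\<And>v. v \<in> C \<Longrightarrow> 0 < c v" "(\<Sum>v\<in>C. c v *\<^sub>R g v) = 0"
      using C(1) unfolding circuits_def pos_circuit_def by blast
    have CV: "C \<subseteq> V" "C \<inter> S = {}" using C(1) by (auto simp: circuits_def)
    obtain f where f: "affine_fun f" "\<And>v. v \<in> V \<Longrightarrow> f v = (if v \<in> C then c v else 0)"
      using circuit_functional[OF CV(1) c(2)] by blast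
    have "0 \<le> f v" if "v \<in> V" for v using f(2)[OF that] c(1)[of v] by (auto simp: less_imp_le)
    moreover have "f v = 0" if "v \<in> S" for v
    proof -
      have "v \<in> V" "v \<notin> C" using that S(1) CV(2) by auto
      then show ?thesis by (simp add: f(2))
    qed
    moreover have "0 < f p" using f(2)[of p] c(1)[of p] C(2) p by auto
    ultimately show "\<exists>f. affine_fun f \<and> (\<forall>v\<in>V. 0 \<le> f v) \<and> (\<forall>v\<in>S. f v = 0) \<and> 0 < f p"
      using f(1) by blast
  qed
  then obtain f where f: "\<And>p. p \<in> ?W \<Longrightarrow> affine_fun (f p)" "\<And>p v. p \<in> ?W \<Longrightarrow> v \<in> V \<Longrightarrow> 0 \<le> f p v"
      "\<And>p v. p \<in> ?W \<Longrightarrow> v \<in> S \<Longrightarrow> f p v = 0" "\<And>p. p \<in> ?W \<Longrightarrow> 0 < f p p"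
    by metis
  define c where "c = (\<lambda>v. \<Sum>p\<in>?W. f p v)"
  have "(\<Sum>v\<in>V. c v *\<^sub>R g v) = (\<Sum>v\<in>V. \<Sum>p\<in>?W. f p v *\<^sub>R g v)"
    by (simp add: c_def scaleR_left.sum)
  also have "\<dots> = (\<Sum>p\<in>?W. \<Sum>v\<in>V. f p v *\<^sub>R g v)" by (rule sum.swap)
  also have "\<dots> = 0" using orth f(1) by simp
  finally obtain h where h: "affine_fun h" "\<And>v. v \<in> V \<Longrightarrow> h v = c v" using complete by blast
  have "0 \<le> h v" if "v \<in> V" for v using h(2)[OF that] f(2)[OF _ that] by (auto simp: c_def intro!: sum_nonneg)
  moreover have "h v = 0" if "v \<in> S" for v using h(2)[of v] f(3) that S(1) by (auto simp: c_def)
  moreover have "h v \<noteq> 0" if "v \<in> ?W" for v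
  proof -
    have "0 < c v" unfolding c_def
      using sum_pos2[OF finW that, of "\<lambda>p. f p v"] f(2,4) that by simp
    then show ?thesis using h(2)[of v] that by simp
  qed
  ultimately have "{v\<in>V. h v = 0} = S" "\<forall>v\<in>V. 0 \<le> h v" using S(1) by blast+
  then show ?thesis using h(1) by blast
qed

lemma half_planes_neighborly:
  assumes H: "half_planes (k + 1) V g" and k: "1 \<le> k"
  shows "vertices P = V" "neighborly k P"
proof -
  have "v extreme_point_of P" if v: "v \<in> V" for v
  proof -
    obtain f where f: "affine_fun f" "\<forall>v\<in>V. 0 \<le> f v" "{u\<in>V. f u = 0} = {v}"
      using half_planes_exposed[OF H, of "{v}"] v k by auto
    then have "convex hull {v} face_of P" using exposed_face(1)[OF f(1)] by auto
    then show ?thesis by (simp add: face_of_singleton)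
  qed
  then show VP: "vertices P = V" using extreme_point_of_convex_hull by (auto simp: vertices_def)
  show "neighborly k P"
    unfolding neighborly_def VP
  proof (intro allI impI, elim conjE)
    fix S assume S: "S \<subseteq> V" "card S = k"
    then obtain f where f: "affine_fun f" "\<forall>v\<in>V. 0 \<le> f v" "{v\<in>V. f v = 0} = S"
      using half_planes_exposed[OF H, of S] by auto
    then have F: "convex hull S face_of P" "V \<inter> convex hull S = S"
      using exposed_face[OF f(1)] by auto
    then have "vertices (convex hull S) = S" using vertices_face[OF F(1)] VP by simp
    then show "\<exists>F. F face_of P \<and> vertices F = S" using F(1) by blast
  qed
qed

text \<open>The converse reading of \<open>orth\<close>: every linear functional of the plane gives
  an affine dependence of the points. Linear functionals separate a nonzero vector from 0 in any
  real vector space.\<close>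

lemma dependence:
  shows "(\<Sum>v\<in>V. z \<bullet> g v) = 0" "(\<Sum>v\<in>V. (z \<bullet> g v) *\<^sub>R v) = 0"
proof -
  have *: "(\<Sum>v\<in>V. f v * (z \<bullet> g v)) = 0" if "affine_fun f" for f
    using sum_scaleR_zero_inner[OF orth[OF that]] .
  show "(\<Sum>v\<in>V. z \<bullet> g v) = 0" using *[OF affine_fun_const[of 1]] by simp
  let ?w = "\<Sum>v\<in>V. (z \<bullet> g v) *\<^sub>R v"
  show "?w = 0"
  proof (rule ccontr)
    assume "?w \<noteq> 0"
    then have "independent {?w}" by simp
    then obtain L :: "'a \<Rightarrow> real" where L: "linear L" "L ?w = 1"
      using linear_independent_extend[of "{?w}" "\<lambda>_. 1"] by auto
    have "L ?w = (\<Sum>v\<in>V. L v * (z \<bullet> g v))"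
      using L(1) by (simp add: linear_sum linear_scale mult.commute)
    then show False using *[OF affine_fun_linear[OF L(1)]] L(2) by simp
  qed
qed

text \<open>Splitting the dependence for \<open>z\<close> by sign gives a Radon point
  \<open>x\<close> common to the hulls of \<open>H\<close> and \<open>N\<close>. If \<open>H\<close>
  had at most \<open>k\<close> elements, it would extend to a \<open>k\<close>-set \<open>S\<close>
  missing some \<open>n0\<close> in \<open>N\<close>. The face with vertex set \<open>S\<close>
  contains \<open>x\<close>, hence all of \<open>N\<close>, and so has the additional vertex
  \<open>n0\<close>.\<close>

lemma neighborly_half_planes:
  assumes nb: "neighborly k P" and VP: "vertices P = V" and card: "k + 1 \<le> card V"
  shows "half_planes (k + 1) V g"
  unfolding half_planes_def
proof (intro allI impI)
  fix z :: complex assume z: "z \<noteq> 0"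
  define H where "H = {v\<in>V. 0 < z \<bullet> g v}"
  define N where "N = {v\<in>V. z \<bullet> g v < 0}"
  have fin: "finite H" "finite N" using finV by (auto simp: H_def N_def)
  have split: "(\<Sum>v\<in>V. (z \<bullet> g v) *\<^sub>R h v) = (\<Sum>v\<in>H. (z \<bullet> g v) *\<^sub>R h v) + (\<Sum>v\<in>N. (z \<bullet> g v) *\<^sub>R h v)"
    for h :: "'a \<Rightarrow> 'b::real_vector"
  proof -
    have "(\<Sum>v\<in>V. (z \<bullet> g v) *\<^sub>R h v) = (\<Sum>v\<in>H \<union> N. (z \<bullet> g v) *\<^sub>R h v)"
      using finV by (intro sum.mono_neutral_right) (auto simp: H_def N_def)
    then show ?thesis using fin by (subst (asm) sum.union_disjoint) (auto simp: H_def N_def)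
  qed
  define s where "s = (\<Sum>v\<in>H. z \<bullet> g v)"
  have sN: "(\<Sum>v\<in>N. - (z \<bullet> g v)) = s"
    using dependence(1)[of z] split[of "\<lambda>_. 1::real"] by (simp add: s_def sum_negf)
  have eq: "(\<Sum>v\<in>N. (- (z \<bullet> g v)) *\<^sub>R v) = (\<Sum>v\<in>H. (z \<bullet> g v) *\<^sub>R v)"
    using dependence(2)[of z] split[of "\<lambda>v. v"] by (simp add: sum_negf neg_eq_iff_add_eq_0 add.commute)
  have spos: "0 < s"
  proof -
    obtain v where v: "v \<in> V" "z \<bullet> g v \<noteq> 0" using spanning[OF z] by blast
    then have "v \<in> H \<or> v \<in> N" by (auto simp: H_def N_def)
    then show ?thesis
    proof
      assume "v \<in> H"
      then show ?thesis unfolding s_def using fin by (intro sum_pos) (auto simp: H_def)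
    next
      assume "v \<in> N"
      then show ?thesis unfolding sN[symmetric] using fin by (intro sum_pos) (auto simp: N_def)
    qed
  qed
  have "N \<noteq> {}" using sN spos by auto
  then obtain n0 where n0: "n0 \<in> N" by blast
  show "k + 1 \<le> card {v\<in>V. 0 < z \<bullet> g v}"
  proof (rule ccontr)
    assume "\<not> ?thesis"
    then have Hk: "card H \<le> k" by (simp add: H_def)
    have n0V: "n0 \<in> V" using n0 by (simp add: N_def)
    have "k \<le> card (V - {n0})" using card n0V finV by simp
    moreover have "H \<subseteq> V - {n0}" using n0 by (auto simp: H_def N_def)
    ultimately obtain S where S: "H \<subseteq> S" "S \<subseteq> V - {n0}" "card S = k"
      using exists_subset_between[of H k "V - {n0}"] Hk finV by auto
    have "S \<subseteq> vertices P" using S(2) VP by auto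
    then obtain F where F: "F face_of P" "vertices F = S"
      using nb S(3) unfolding neighborly_def by blast
    have SF: "S \<subseteq> F" using F(2) by (auto simp: vertices_def extreme_point_of_def)
    define x where "x = (\<Sum>v\<in>H. ((z \<bullet> g v) / s) *\<^sub>R v)"
    have xN: "x = (\<Sum>v\<in>N. ((- (z \<bullet> g v)) / s) *\<^sub>R v)"
    proof -
      have "x = (1 / s) *\<^sub>R (\<Sum>v\<in>H. (z \<bullet> g v) *\<^sub>R v)" by (simp add: x_def scaleR_right.sum)
      also have "\<dots> = (1 / s) *\<^sub>R (\<Sum>v\<in>N. (- (z \<bullet> g v)) *\<^sub>R v)" by (simp only: eq)
      also have "\<dots> = (\<Sum>v\<in>N. ((- (z \<bullet> g v)) / s) *\<^sub>R v)" by (simp add: scaleR_right.sum)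
      finally show ?thesis .
    qed
    have "x \<in> F" unfolding x_def
    proof (rule convex_sum[OF fin(1) face_of_imp_convex[OF F(1)]])
      show "(\<Sum>v\<in>H. (z \<bullet> g v) / s) = 1" using spos by (simp add: s_def flip: sum_divide_distrib)
    qed (use S(1) SF spos in \<open>auto simp: H_def\<close>)
    have "N \<subseteq> F"
    proof (rule face_contains_support[OF F(1) convex_convex_hull fin(2)])
      show "N \<subseteq> P" using V_P by (auto simp: N_def)
      show "0 < (- (z \<bullet> g w)) / s" if "w \<in> N" for w using that spos by (simp add: N_def divide_neg_pos)
      show "(\<Sum>v\<in>N. (- (z \<bullet> g v)) / s) = 1"
        unfolding sum_divide_distrib[symmetric] sN using spos by simp
      show "(\<Sum>v\<in>N. ((- (z \<bullet> g v)) / s) *\<^sub>R v) \<in> F" using \<open>x \<in> F\<close> xN by simp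
    qed
    then have "n0 \<in> vertices F" using n0 n0V vertices_face[OF F(1)] VP by blast
    then show False using F(2) S(2) by blast
  qed
qed

end

text \<open>The real and imaginary parts of \<open>g\<close> are two affine dependences, which gives
  \<open>orth\<close>. For \<open>complete\<close>, fit a functional on the basis \<open>B\<close>;
  the difference is a dependence of the two remaining vectors 1 and \<open>\<i>\<close>, hence
  trivial.\<close>

lemma gale_of_basis:
  fixes B :: "'a::real_vector set" and p q :: 'a and g :: "'a \<Rightarrow> complex"
  defines "V \<equiv> insert p (insert q B)"
  assumes B: "finite B" "\<not> affine_dependent B" "card B = d + 1" and d: "1 \<le> d"
    and pq: "p \<notin> B" "q \<notin> B" "p \<noteq> q" and g: "g p = 1" "g q = \<i>"
    and sum0: "(\<Sum>v\<in>V. g v) = 0" and Re0: "(\<Sum>v\<in>V. Re (g v) *\<^sub>R v) = 0"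
    and Im0: "(\<Sum>v\<in>V. Im (g v) *\<^sub>R v) = 0" and hull: "affine hull V = affine hull B"
  shows "gale V g d"
proof
  show "finite V" using B by (simp add: V_def)
  show "1 \<le> d" by (rule d)
  show "\<exists>B. finite B \<and> \<not> affine_dependent B \<and> affine hull B = affine hull V \<and> card B = d + 1"
    using B hull by metis
  show orth: "(\<Sum>v\<in>V. f v *\<^sub>R g v) = 0" if f: "affine_fun f" for f
  proof -
    obtain L t where L: "linear L"
      "\<And>u S. (\<Sum>v\<in>S. u v * f v) = L (\<Sum>v\<in>S. u v *\<^sub>R v) + t * sum u S"
      using affine_fun_weighted[OF f] by metis
    have "(\<Sum>v\<in>V. Re (g v)) = 0" "(\<Sum>v\<in>V. Im (g v)) = 0"
      using sum0 by (simp_all flip: Re_sum Im_sum)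
    then have "(\<Sum>v\<in>V. Re (g v) * f v) = 0" "(\<Sum>v\<in>V. Im (g v) * f v) = 0"
      unfolding L(2) Re0 Im0 using linear_0[OF L(1)] by simp_all
    then show ?thesis by (intro complex_eqI) (simp_all add: mult.commute)
  qed
  show "\<exists>f. affine_fun f \<and> (\<forall>v\<in>V. f v = c v)" if c: "(\<Sum>v\<in>V. c v *\<^sub>R g v) = 0" for c
  proof -
    obtain f where f: "affine_fun f" "\<And>b. b \<in> B \<Longrightarrow> f b = c b"
      using affine_fun_extend[OF B(2), of c] by blast
    have "(\<Sum>v\<in>V. (f v - c v) *\<^sub>R g v) = 0"
      using c orth[OF f(1)] by (simp add: scaleR_diff_left sum_subtractf)
    moreover have "(\<Sum>v\<in>V. (f v - c v) *\<^sub>R g v) = (f p - c p) *\<^sub>R 1 + (f q - c q) *\<^sub>R \<i>"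
      using B(1) pq g f(2) by (simp add: V_def)
    ultimately have "f p = c p" "f q = c q" by (auto simp: complex_eq_iff)
    then show ?thesis using f by (intro exI[of _ f]) (auto simp: V_def)
  qed
  show "\<exists>v\<in>V. z \<bullet> g v \<noteq> 0" if "z \<noteq> 0" for z
  proof -
    have "z \<bullet> g p = Re z" "z \<bullet> g q = Im z" by (simp_all add: g inner_complex_def)
    then show ?thesis using that by (auto simp: V_def complex_eq_iff)
  qed
qed

text \<open>Two vertices remain outside an affine basis. Writing each as an affine combination of
  the basis gives two dependences, whose coefficients at a vertex are the two coordinates of its
  vector.\<close>

lemma gale_exists:
  fixes P :: "'a::real_vector set"
  assumes P: "d_polytope d P" and card: "card (vertices P) = d + 3" and d: "1 \<le> d"
  shows "\<exists>g. gale (vertices P) g d"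
proof -
  let ?V = "vertices P"
  have finV: "finite ?V" and hullV: "P = convex hull ?V"
    using polytope_eq_hull_vertices P unfolding d_polytope_def by blast+
  obtain B0 where B0: "finite B0" "\<not> affine_dependent B0" "affine hull B0 = affine hull P" "card B0 = d + 1"
    using P unfolding d_polytope_def has_aff_dim_def by (metis of_nat_1 of_nat_add of_nat_eq_iff)
  have affP: "affine hull P = affine hull ?V" by (metis hullV affine_hull_convex_hull)
  obtain B where B: "B \<subseteq> ?V" "\<not> affine_dependent B" "affine hull ?V = affine hull B"
    using affine_basis_exists[of ?V] by blast
  have fB: "finite B" using B(1) finV finite_subset by blast
  have "B \<subseteq> affine hull B0" "B0 \<subseteq> affine hull B"
    using B(3) B0(3) affP hull_subset[of B affine] hull_subset[of B0 affine] by simp_all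
  then have cB: "card B = d + 1"
    using affine_independent_card_le[OF B(2) B0(1)] affine_independent_card_le[OF B0(2) fB] B0(4)
    by simp
  have "card (?V - B) = 2" using card cB fB B(1) by (simp add: card_Diff_subset)
  then obtain p q where pq: "?V - B = {p, q}" "p \<noteq> q" unfolding card_2_iff by blast
  have V: "?V = insert p (insert q B)" using pq(1) B(1) by blast
  have nin: "p \<notin> B" "q \<notin> B" using pq(1) by blast+
  have "p \<in> affine hull B" "q \<in> affine hull B"
    using B(3) V hull_subset[of ?V affine] by auto
  then obtain \<alpha> \<beta> where ab: "sum \<alpha> B = 1" "(\<Sum>v\<in>B. \<alpha> v *\<^sub>R v) = p" "sum \<beta> B = 1" "(\<Sum>v\<in>B. \<beta> v *\<^sub>R v) = q"
    unfolding affine_hull_finite[OF fB] by blast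
  define g where "g = (\<lambda>v. if v = p then 1 else if v = q then \<i> else Complex (- \<alpha> v) (- \<beta> v))"
  have gB: "g v = Complex (- \<alpha> v) (- \<beta> v)" if "v \<in> B" for v using that nin by (auto simp: g_def)
  have gpq: "g p = 1" "g q = \<i>" using pq(2) by (simp_all add: g_def)
  have S: "(\<Sum>v\<in>insert p (insert q B). F v) = F p + (F q + sum F B)" for F :: "'a \<Rightarrow> 'b::comm_monoid_add"
    using fB nin pq(2) by simp
  have "gale (insert p (insert q B)) g d"
  proof (rule gale_of_basis[OF fB B(2) cB d nin pq(2) gpq])
    have "(\<Sum>v\<in>B. g v) = Complex (- sum \<alpha> B) (- sum \<beta> B)"
      using gB by (intro complex_eqI) (simp_all add: sum_negf)
    then show "(\<Sum>v\<in>insert p (insert q B). g v) = 0"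
      unfolding S gpq ab by (simp add: complex_eq_iff)
    have "(\<Sum>v\<in>B. Re (g v) *\<^sub>R v) = - p" "(\<Sum>v\<in>B. Im (g v) *\<^sub>R v) = - q"
      unfolding ab(2,4)[symmetric] using gB by (simp_all add: sum_negf)
    then show "(\<Sum>v\<in>insert p (insert q B). Re (g v) *\<^sub>R v) = 0"
      "(\<Sum>v\<in>insert p (insert q B). Im (g v) *\<^sub>R v) = 0"
      unfolding S gpq by simp_all
    show "affine hull insert p (insert q B) = affine hull B" using B(3) V by simp
  qed
  then show ?thesis using V by metis
qed

lemma excess_lower_bound:
  assumes k: "2 \<le> k" and x: "x \<in> excess_values k"
  shows "target k \<le> x"
proof -
  obtain P :: "(nat \<Rightarrow>\<^sub>0 real) set" and d where P: "d_polytope d P" "2 * k \<le> d" "neighborly k P"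
      "card (vertices P) = d + 3" and x': "x = int (card (facets P)) - int (card (vertices P))"
    using x unfolding excess_values_def by blast
  obtain g where "gale (vertices P) g d" using gale_exists[OF P(1,4)] P(2) k by auto
  then interpret gale "vertices P" g d .
  have hull: "convex hull (vertices P) = P"
    using polytope_eq_hull_vertices(2) P(1) unfolding d_polytope_def by blast
  have "half_planes (k + 1) (vertices P) g"
    by (rule neighborly_half_planes) (use P hull in auto)
  then have "target k \<le> int (card (circuits (vertices P) g)) - int (card (vertices P))"
    using circuits_lower_bound[OF finV] k by blast
  then show ?thesis using card_facets unfolding hull x' by simp
qed

subsection \<open>Extremal configurations\<close>

text \<open>Pairwise nonparallel directions, starting with 1 and \<open>\<i>\<close>, the two
  vectors that \<open>gale_of_basis\<close> prescribes.\<close>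

definition ray :: "nat \<Rightarrow> complex" where
  "ray j = (if j = 0 then 1 else Complex (real (j - 1)) 1)"

lemma cr_ray: "cr (ray i) (ray j) = 0 \<longleftrightarrow> i = j"
  by (auto simp: ray_def cr_def)

lemma ray_nonzero [simp]: "ray j \<noteq> 0"
  by (simp add: ray_def complex_eq_iff)

text \<open>\<open>star m w\<close> indexes \<open>w\<close> copies of each of the \<open>2 * m\<close> directions of the first \<open>m\<close> rays
  and their negatives.\<close>

definition star :: "nat \<Rightarrow> nat \<Rightarrow> (nat \<times> nat \<times> bool) set" where
  "star m w = {..<m} \<times> {..<w} \<times> UNIV"

definition vec :: "nat \<times> nat \<times> bool \<Rightarrow> complex" where
  "vec x = (case x of (j, r, s) \<Rightarrow> if s then ray j else - ray j)"

lemma finite_star [simp]: "finite (star m w)"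
  by (simp add: star_def)

lemma sum_star:
  fixes F :: "complex \<Rightarrow> 'b::real_vector"
  shows "(\<Sum>x\<in>star m w. F (vec x)) = real w *\<^sub>R (\<Sum>j<m. F (ray j) + F (- ray j))"
proof -
  have "(\<Sum>x\<in>star m w. F (vec x)) = (\<Sum>(j,r,s)\<in>star m w. F (if s then ray j else - ray j))"
    by (intro sum.cong refl) (auto simp: vec_def)
  also have "\<dots> = (\<Sum>j<m. \<Sum>r<w. \<Sum>s\<in>UNIV. F (if s then ray j else - ray j))"
    unfolding star_def by (simp add: sum.cartesian_product)
  also have "\<dots> = (\<Sum>j<m. real w *\<^sub>R (F (ray j) + F (- ray j)))"
    by (simp add: UNIV_bool sum_constant_scaleR add.commute)
  finally show ?thesis by (simp add: scaleR_right.sum)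
qed

lemma card_star_filter:
  "card {x\<in>star m w. Q (vec x)} = w * (card {j\<in>{..<m}. Q (ray j)} + card {j\<in>{..<m}. Q (- ray j)})"
proof -
  have c: "real (card {x\<in>A. R x}) = (\<Sum>x\<in>A. of_bool (R x))" if "finite A" for A :: "'c set" and R
    using that by (simp add: Int_def)
  have "real (card {x\<in>star m w. Q (vec x)}) =
      real w * (real (card {j\<in>{..<m}. Q (ray j)}) + real (card {j\<in>{..<m}. Q (- ray j)}))"
    using sum_star[of "\<lambda>u. of_bool (Q u) :: real" m w] by (simp only: c finite_star finite_lessThan sum.distrib real_scaleR_def)
  then have "real (card {x\<in>star m w. Q (vec x)}) =
      real (w * (card {j\<in>{..<m}. Q (ray j)} + card {j\<in>{..<m}. Q (- ray j)}))" by simp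
  then show ?thesis by (simp only: of_nat_eq_iff)
qed

lemma card_star: "card (star m w) = 2 * m * w"
  by (simp add: star_def card_cartesian_product UNIV_bool)

text \<open>At most one of the \<open>m\<close> lines is orthogonal to \<open>z\<close>; each of the
  others has one of its two directions, with \<open>w\<close> vectors, on the positive side.\<close>

lemma star_half_planes:
  assumes z: "z \<noteq> 0"
  shows "(m - 1) * w \<le> card {x\<in>star m w. 0 < z \<bullet> vec x}"
proof -
  let ?A = "{j\<in>{..<m}. 0 < z \<bullet> ray j}" and ?B = "{j\<in>{..<m}. 0 < z \<bullet> - ray j}"
    and ?Z = "{j\<in>{..<m}. z \<bullet> ray j = 0}"
  have "i = j" if "z \<bullet> ray i = 0" "z \<bullet> ray j = 0" for i j
  proof -
    have "(z \<bullet> z) * cr (ray i) (ray j) = 0"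
    proof -
      have "(z \<bullet> z) * cr (ray i) (ray j) = (z \<bullet> ray i) * cr z (ray j) - (z \<bullet> ray j) * cr z (ray i)"
        by (rule cr_expand)
      then show ?thesis using that by simp
    qed
    then show ?thesis using z cr_ray by simp
  qed
  then have "card ?Z \<le> Suc 0" by (subst card_le_Suc0_iff_eq) auto
  moreover have "m = card ?A + card ?B + card ?Z"
  proof -
    have "{..<m} = (?A \<union> ?B) \<union> ?Z" by auto
    then have "card {..<m} = card ((?A \<union> ?B) \<union> ?Z)" by (rule arg_cong)
    also have "\<dots> = card (?A \<union> ?B) + card ?Z" by (intro card_Un_disjoint) auto
    also have "card (?A \<union> ?B) = card ?A + card ?B" by (intro card_Un_disjoint) auto
    finally show ?thesis by (simp only: card_lessThan)
  qed
  ultimately have "m - 1 \<le> card ?A + card ?B" by linarith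
  then have "(m - 1) * w \<le> w * (card ?A + card ?B)" by (simp add: mult.commute)
  then show ?thesis using card_star_filter[of m w "\<lambda>u. 0 < z \<bullet> u"] by simp
qed

lemma star_counts:
  assumes "x \<in> star m w"
  shows "card {y\<in>star m w. cr (vec x) (vec y) = 0} = 2 * w"
    "card {y\<in>star m w. opp (vec x) (vec y)} = w"
    "card {y\<in>star m w. 0 < cr (vec x) (vec y)} = card {y\<in>star m w. cr (vec x) (vec y) < 0}"
proof -
  obtain j r s where x: "x = (j, r, s)" and j: "j < m" using assms by (cases x) (auto simp: star_def)
  have v: "vec x = ray j \<or> vec x = - ray j" by (simp add: x vec_def)
  have neg: "cr (- a) b = - cr a b" "cr a (- b) = - cr a b" for a b by (simp_all add: cr_def)
  have c0: "cr (vec x) (ray i) = 0 \<longleftrightarrow> i = j" for i using v cr_ray[of j i] by (auto simp: neg)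
  have single: "{i. i < m \<and> i = j} = {j}" "{i. i = j \<and> i < m} = {j}" using j by auto
  show "card {y\<in>star m w. cr (vec x) (vec y) = 0} = 2 * w"
    by (subst card_star_filter) (simp add: neg c0 single)
  have rr: "ray j \<bullet> ray j < 0 \<Longrightarrow> False" using inner_ge_zero[of "ray j"] by linarith
  have ne: "ray j \<noteq> - ray j" "- ray j \<noteq> ray j" by (auto simp: complex_eq_iff ray_def)
  have o: "opp (vec x) (ray i) \<longleftrightarrow> i = j \<and> vec x = - ray j"
    "opp (vec x) (- ray i) \<longleftrightarrow> i = j \<and> vec x = ray j" for i
    unfolding opp_def neg neg_equal_0_iff_equal c0 using v ne by (auto dest: rr)
  show "card {y\<in>star m w. opp (vec x) (vec y)} = w"
    using v ne by (subst card_star_filter) (auto simp: o single)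
  show "card {y\<in>star m w. 0 < cr (vec x) (vec y)} = card {y\<in>star m w. cr (vec x) (vec y) < 0}"
    unfolding card_star_filter[of m w "\<lambda>u. 0 < cr (vec x) u"] card_star_filter[of m w "\<lambda>u. cr (vec x) u < 0"]
    by (simp add: neg)
qed

text \<open>By symmetry every vector has \<open>s = 2 * w\<close>, \<open>e = 0\<close> and
  \<open>D = 0\<close>, so all summands of \<open>excess_identity\<close> agree.\<close>

lemma star_excess:
  assumes inj: "inj_on pt (star m w)" and g: "\<And>x. x \<in> star m w \<Longrightarrow> g (pt x) = vec x"
  defines "n \<equiv> real (2 * m * w)"
  shows "24 * (real (card (circuits (pt ` star m w) g)) - n) =
      n * (n\<^sup>2 - 6 * n * real w + 8 * (real w)\<^sup>2 + 12 * real w - 24)"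
    and "half_planes ((m - 1) * w) (pt ` star m w) g"
proof -
  let ?V = "pt ` star m w"
  have cnt: "card {v\<in>?V. Q (g v)} = card {x\<in>star m w. Q (vec x)}" for Q
  proof -
    have "{v\<in>?V. Q (g v)} = pt ` {x\<in>star m w. Q (vec x)}" using g by auto
    moreover have "inj_on pt {x\<in>star m w. Q (vec x)}" by (rule inj_on_subset[OF inj]) auto
    ultimately show ?thesis by (simp add: card_image)
  qed
  interpret config ?V g
  proof
    show "g v \<noteq> 0" if "v \<in> ?V" for v using that g by (auto simp: vec_def split: if_splits)
  qed simp
  have cV: "card ?V = 2 * m * w" using card_image[OF inj] by (simp add: card_star)
  have vals: "s p = 2 * real w" "e p = 0" "D p = 0" if p: "p \<in> ?V" for p
  proof -
    obtain x where x: "x \<in> star m w" "p = pt x" using p by blast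
    have gp: "g p = vec x" using g x by simp
    show s: "s p = 2 * real w"
      unfolding s_card gp cnt[of "\<lambda>u. cr (vec x) u = 0"] using star_counts(1)[OF x(1)] by simp
    have "y p = real w"
      unfolding y_def gp cnt[of "\<lambda>u. opp (vec x) u"] using star_counts(2)[OF x(1)] by simp
    then show "e p = 0" using s by (simp add: e_eq)
    show "D p = 0"
      unfolding side_counts gp cnt[of "\<lambda>u. 0 < cr (vec x) u"] cnt[of "\<lambda>u. cr (vec x) u < 0"]
      using star_counts(3)[OF x(1)] by simp
  qed
  have "24 * (real (card (circuits ?V g)) - n) =
      (\<Sum>p\<in>?V. n\<^sup>2 - 6 * n * real w + 8 * (real w)\<^sup>2 + 12 * real w - 24)"
    using excess_identity unfolding cV n_def[symmetric]
    by (simp add: vals power_mult_distrib cong: sum.cong)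
  then show "24 * (real (card (circuits ?V g)) - n) =
      n * (n\<^sup>2 - 6 * n * real w + 8 * (real w)\<^sup>2 + 12 * real w - 24)"
    by (simp add: cV n_def)
  show "half_planes ((m - 1) * w) ?V g"
    unfolding half_planes_def using star_half_planes cnt[of "\<lambda>u. 0 < _ \<bullet> u"] by simp
qed

section \<open>Polytopes with a star as Gale diagram\<close>

lemma lookup_scaleR: "Poly_Mapping.lookup (c *\<^sub>R f) i = c *\<^sub>R Poly_Mapping.lookup f i"
  for f :: "'a \<Rightarrow>\<^sub>0 'b::real_vector"
proof -
  have "finite {i. c *\<^sub>R Poly_Mapping.lookup f i \<noteq> 0}"
    by (rule finite_subset[OF _ finite_lookup[of f]]) auto
  then show ?thesis by (simp add: scaleR_poly_mapping_def)
qed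

text \<open>The polytope is recovered from its diagram: the indices other than \<open>p0\<close> and
  \<open>q0\<close> become unit vectors, and the dependences given by the real and imaginary parts
  then determine the last two points \<open>p\<close> and \<open>q\<close>.\<close>

lemma star_polytope:
  assumes m: "2 \<le> m" and w: "1 \<le> w" and mw: "2 \<le> w \<or> 3 \<le> m"
    and k: "1 \<le> k" "(m - 1) * w = k + 1" "2 * k + 3 \<le> 2 * m * w"
  defines "n \<equiv> real (2 * m * w)"
  shows "\<exists>x\<in>excess_values k. 24 * real_of_int x =
    n * (n\<^sup>2 - 6 * n * real w + 8 * (real w)\<^sup>2 + 12 * real w - 24)"
proof -
  let ?I = "star m w"
  define p0 :: "nat \<times> nat \<times> bool" where "p0 = (0, 0, True)"
  define q0 :: "nat \<times> nat \<times> bool" where "q0 = (1, 0, True)"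
  define J where "J = ?I - {p0, q0}"
  have pqI: "p0 \<in> ?I" "q0 \<in> ?I" "p0 \<noteq> q0" using m w by (auto simp: p0_def q0_def star_def)
  have fJ: "finite J" by (simp add: J_def)
  have IJ: "?I = insert p0 (insert q0 J)" "p0 \<notin> insert q0 J" "q0 \<notin> J" using pqI by (auto simp: J_def)
  have vpq: "vec p0 = 1" "vec q0 = \<i>" by (simp_all add: p0_def q0_def vec_def ray_def complex_eq_iff)
  define e where "e = (\<lambda>x::nat \<times> nat \<times> bool. Poly_Mapping.single (to_nat x) (1::real))"
  define lk where "lk = (\<lambda>(f::nat \<Rightarrow>\<^sub>0 real) (y::nat \<times> nat \<times> bool). Poly_Mapping.lookup f (to_nat y))"
  have lke: "lk (e x) y = of_bool (x = y)" for x y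
    by (simp add: lk_def e_def lookup_single when_def)
  have lks: "lk (\<Sum>x\<in>J. a x *\<^sub>R e x) y = (if y \<in> J then a y else 0)" for a y
  proof -
    have "lk (\<Sum>x\<in>J. a x *\<^sub>R e x) y = (\<Sum>x\<in>J. a x * lk (e x) y)"
      by (simp add: lk_def lookup_sum lookup_scaleR)
    also have "\<dots> = (\<Sum>x\<in>J. if x = y then a x else 0)"
      by (intro sum.cong refl) (simp add: lke)
    finally show ?thesis using fJ by simp
  qed
  have inje: "inj_on e A" for A
  proof (rule inj_onI)
    fix x y assume "e x = e y"
    then have "lk (e x) x = lk (e y) x" by simp
    then show "x = y" by (simp add: lke split: if_splits)
  qed
  define p where "p = (\<Sum>x\<in>J. (- Re (vec x)) *\<^sub>R e x)"
  define q where "q = (\<Sum>x\<in>J. (- Im (vec x)) *\<^sub>R e x)"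
  define B where "B = e ` J"
  have lkp: "lk p y = - Re (vec y)" "lk q y = - Im (vec y)" if "y \<in> J" for y
    using that by (simp_all only: p_def q_def lks if_True)
  \<comment> \<open>Witnesses of a negative coordinate of \<open>p\<close> and of \<open>q\<close>,
    which keeps both apart from the unit vectors. A second copy of 1 and of \<open>\<i>\<close>
    serves if \<open>w\<close> is at least 2; otherwise the third ray, \<open>1 + \<i>\<close>,
    serves for both, which is the reason for the assumption \<open>mw\<close>.\<close>
  obtain x1 x2 where x12: "x1 \<in> J" "x2 \<in> J" "0 < Re (vec x1)" "0 < Im (vec x2)"
  proof (cases "2 \<le> w")
    case True
    then show ?thesis using that[of "(0, 1, True)" "(1, 1, True)"] m
      by (auto simp: J_def star_def p0_def q0_def vec_def ray_def)
  next
    case False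
    then show ?thesis using that[of "(2, 0, True)" "(2, 0, True)"] m w mw
      by (auto simp: J_def star_def p0_def q0_def vec_def ray_def)
  qed
  have pB: "p \<notin> B"
  proof
    assume "p \<in> B"
    then obtain x where "p = e x" by (auto simp: B_def)
    then have "0 \<le> lk p x1" by (simp add: lke)
    then show False using lkp(1)[OF x12(1)] x12(3) by simp
  qed
  have qB: "q \<notin> B"
  proof
    assume "q \<in> B"
    then obtain x where "q = e x" by (auto simp: B_def)
    then have "0 \<le> lk q x2" by (simp add: lke)
    then show False using lkp(2)[OF x12(2)] x12(4) by simp
  qed
  have pq: "p \<noteq> q"
  proof -
    \<comment> \<open>At the vector -1 the coordinates of \<open>p\<close> and \<open>q\<close> are
      1 and 0.\<close>
    have y: "(0, 0, False) \<in> J" using m w by (auto simp: J_def star_def p0_def q0_def)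
    have "lk p (0, 0, False) \<noteq> lk q (0, 0, False)"
      unfolding lkp[OF y] by (simp add: vec_def ray_def)
    then show ?thesis by blast
  qed
  define pt where "pt = (\<lambda>x. if x = p0 then p else if x = q0 then q else e x)"
  have ptJ: "pt x = e x" if "x \<in> J" for x using that IJ by (auto simp: pt_def)
  have ptpq: "pt p0 = p" "pt q0 = q" using pqI by (simp_all add: pt_def)
  have "pt ` J = B" unfolding B_def using ptJ by (intro image_cong) auto
  then have V: "pt ` ?I = insert p (insert q B)" unfolding IJ(1) by (simp add: ptpq)
  have inj: "inj_on pt ?I"
  proof -
    have "inj_on pt J" using inje[of J] ptJ by (simp cong: inj_on_cong)
    then show ?thesis unfolding IJ(1) using IJ(2,3) pB qB pq \<open>pt ` J = B\<close> ptpq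
      by (auto simp: inj_on_insert)
  qed
  define g where "g = (\<lambda>v. vec (inv_into ?I pt v))"
  have g: "g (pt x) = vec x" if "x \<in> ?I" for x using inj that by (simp add: g_def)
  have gpq: "g p = 1" "g q = \<i>" using g[OF pqI(1)] g[OF pqI(2)] by (simp_all add: ptpq vpq)
  have gB: "g (e x) = vec x" if "x \<in> J" for x using g[of x] ptJ[OF that] that IJ(1) by simp
  have S: "(\<Sum>v\<in>insert p (insert q B). F v) = F p + (F q + (\<Sum>x\<in>J. F (e x)))"
    for F :: "(nat \<Rightarrow>\<^sub>0 real) \<Rightarrow> 'c::comm_monoid_add"
    using pB qB pq fJ by (simp add: B_def sum.reindex[OF inje])
  have v0: "1 + (\<i> + (\<Sum>x\<in>J. vec x)) = 0"
  proof -
    have "(\<Sum>x\<in>?I. vec x) = 0" using sum_star[of "\<lambda>u. u" m w] by simp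
    then show ?thesis unfolding IJ(1) using IJ(2,3) fJ by (simp add: vpq)
  qed
  \<comment> \<open>All vectors of the star cancel and the two removed ones are 1 and
    \<open>\<i>\<close>, so the coefficients of \<open>p\<close> and of \<open>q\<close> sum to 1,
    and both points are in the affine hull of \<open>B\<close>.\<close>
  have sJ: "(\<Sum>x\<in>J. - Re (vec x)) = 1" "(\<Sum>x\<in>J. - Im (vec x)) = 1"
    using v0 by (simp_all add: complex_eq_iff sum_negf)
  have cJ: "card J = 2 * m * w - 2"
  proof -
    have "card ?I = card J + 2" unfolding IJ(1) using IJ(2,3) fJ by simp
    then show ?thesis by (simp add: card_star)
  qed
  let ?d = "2 * m * w - 3"
  have d: "2 * k \<le> ?d" "2 * m * w = ?d + 3" using k by linarith+
  have cB: "card B = ?d + 1" unfolding B_def using card_image[OF inje] cJ k by simp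
  have fB: "finite B" using fJ by (simp add: B_def)
  have indep: "\<not> affine_dependent B"
  proof
    assume "affine_dependent B"
    then obtain U where U: "\<exists>v\<in>B. U v \<noteq> 0" "(\<Sum>v\<in>B. U v *\<^sub>R v) = 0"
      unfolding affine_dependent_explicit_finite[OF fB] by blast
    have 0: "(\<Sum>x\<in>J. U (e x) *\<^sub>R e x) = 0"
      using U(2) unfolding B_def by (simp add: sum.reindex[OF inje])
    have "U (e y) = 0" if "y \<in> J" for y
      using lks[of "\<lambda>x. U (e x)" y] that unfolding 0 by (simp add: lk_def)
    then show False using U(1) by (auto simp: B_def)
  qed
  have hull: "p \<in> affine hull B" "q \<in> affine hull B"
  proof -
    have "(\<Sum>v\<in>B. - Re (g v)) = 1" "(\<Sum>v\<in>B. (- Re (g v)) *\<^sub>R v) = p"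
      "(\<Sum>v\<in>B. - Im (g v)) = 1" "(\<Sum>v\<in>B. (- Im (g v)) *\<^sub>R v) = q"
      unfolding B_def sum.reindex[OF inje] p_def q_def using sJ by (simp_all add: gB)
    then show "p \<in> affine hull B" "q \<in> affine hull B"
      unfolding affine_hull_finite[OF fB] by blast+
  qed
  have aff: "affine hull insert p (insert q B) = affine hull B"
  proof -
    have "affine hull insert q B = affine hull B" using hull(2) by (rule hull_redundant)
    moreover have "affine hull insert p (insert q B) = affine hull insert q B"
      by (rule hull_redundant) (use hull(1) calculation in simp)
    ultimately show ?thesis by simp
  qed
  have "gale (insert p (insert q B)) g ?d"
  proof (rule gale_of_basis[OF fB indep cB _ pB qB pq gpq])
    show "1 \<le> ?d" using d k by linarith
    show "(\<Sum>v\<in>insert p (insert q B). g v) = 0"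
      unfolding S gpq using v0 by (simp add: gB)
    have "(\<Sum>x\<in>J. Re (g (e x)) *\<^sub>R e x) = - p" "(\<Sum>x\<in>J. Im (g (e x)) *\<^sub>R e x) = - q"
      by (simp_all add: p_def q_def gB sum_negf)
    then show "(\<Sum>v\<in>insert p (insert q B). Re (g v) *\<^sub>R v) = 0"
      "(\<Sum>v\<in>insert p (insert q B). Im (g v) *\<^sub>R v) = 0"
      unfolding S gpq by simp_all
    show "affine hull insert p (insert q B) = affine hull B" by (rule aff)
  qed
  then interpret gale "pt ` ?I" g ?d unfolding V .
  have H: "half_planes (k + 1) (pt ` ?I) g"
    using star_excess(2)[OF inj g] k(2) by simp
  have nb: "vertices P = pt ` ?I" "neighborly k P" using half_planes_neighborly[OF H k(1)] by simp_all
  have cV: "card (pt ` ?I) = ?d + 3" using card_image[OF inj] d(2) by (simp add: card_star)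
  have "d_polytope ?d P"
    unfolding d_polytope_def has_aff_dim_def
  proof
    show "polytope P" unfolding polytope_def using finV by blast
    show "\<exists>B. finite B \<and> \<not> affine_dependent B \<and> affine hull B = affine hull P \<and> int (card B) = int ?d + 1"
      using fB indep aff cB unfolding affine_hull_convex_hull V by (intro exI[of _ B]) simp
  qed
  then have "int (card (facets P)) - int (card (vertices P)) \<in> excess_values k"
    unfolding excess_values_def using d(1) nb(2) cV nb(1) by (intro CollectI exI[of _ P] exI[of _ ?d]) simp
  moreover have "24 * real_of_int (int (card (facets P)) - int (card (vertices P))) =
      n * (n\<^sup>2 - 6 * n * real w + 8 * (real w)\<^sup>2 + 12 * real w - 24)"
    using star_excess(1)[OF inj g] unfolding card_facets nb(1) cV n_def d(2)[symmetric] by simp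
  ultimately show ?thesis by blast
qed

lemma target_attained:
  assumes k: "2 \<le> k"
  shows "target k \<in> excess_values k"
proof -
  consider "k = 2" | "k = 3" | "4 \<le> k" using k by linarith
  then show ?thesis
  proof cases
    case 1
    then obtain x where "x \<in> excess_values k" "24 * real_of_int x = 96"
      using star_polytope[of 4 1 k] by auto
    then show ?thesis using 1 by (simp add: target_def)
  next
    case 2
    then obtain x where "x \<in> excess_values k" "24 * real_of_int x = 360"
      using star_polytope[of 5 1 k] by auto
    then show ?thesis using 2 by (simp add: target_def)
  next
    case 3
    let ?n = "real (2 * 2 * (k + 1))" and ?w = "real (k + 1)"
    obtain x where x: "x \<in> excess_values k"
      "24 * real_of_int x = ?n * (?n\<^sup>2 - 6 * ?n * ?w + 8 * ?w\<^sup>2 + 12 * ?w - 24)"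
      using star_polytope[of 2 "k + 1" k] 3 by auto
    have "24 * real_of_int x = 24 * real_of_int (2 * ((int k)\<^sup>2 - 1))"
      unfolding x(2) by (simp add: power2_eq_square algebra_simps)
    then have "x = 2 * ((int k)\<^sup>2 - 1)" by linarith
    then show ?thesis using 3 x(1) by (simp add: target_def)
  qed
qed

theorem theorem1:
  shows "(\<forall>k\<ge>2. Delta3 k \<in> excess_values k \<and> (\<forall>m\<in>excess_values k. Delta3 k \<le> m)) \<and>
    Delta3 2 = 4 \<and> Delta3 3 = 15 \<and>
    (\<forall>k\<ge>4. Delta3 k = 2 * ((int k)\<^sup>2 - 1))"
proof -
  \<comment> \<open>\<open>LEAST\<close> over the integers has a known value only once a minimum is
    exhibited; an attained lower bound is such a minimum.\<close>
  have D: "Delta3 k = target k" if "2 \<le> k" for k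
    unfolding Delta3_def
    by (rule Least_equality) (use target_attained excess_lower_bound that in auto)
  have "\<forall>k\<ge>2. Delta3 k \<in> excess_values k \<and> (\<forall>m\<in>excess_values k. Delta3 k \<le> m)"
    using D target_attained excess_lower_bound by simp
  moreover have "Delta3 2 = 4" "Delta3 3 = 15" using D by (simp_all add: target_def)
  moreover have "\<forall>k\<ge>4. Delta3 k = 2 * ((int k)\<^sup>2 - 1)" using D by (simp add: target_def)
  ultimately show ?thesis by blast
qed

end
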